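(* Let $\epsilon>0$. In the distributed streaming model with $k\ge 2$ sites, for any $0\le\phi\le 1$ (in particular for the median, $\phi=1/2$) there is a deterministic algorithm that continuously tracks an $\epsilon$-approximate $\phi$-quantile of $A(t)$ at all times $t$, with total communication cost $O\!\left(\frac{k}{\epsilon}\log n\right)$ over a sequence of $n$ items.
   Context: Distributed streaming model: a sequence $A=(a_1,\dots,a_n)$ of items from the universe $U=\{1,\dots,u\}$ arrives over time; item $a_i$ arrives at time $t_i$ ($t_1<\dots<t_n$) at exactly one of $k$ sites $S_1,\dots,S_k$. Each site has a two-way communication channel with a designated coordinator $C$ (no direct site-to-site communication). A site may initiate communication only upon the arrival of an item at it; communication is instantaneous. $A(t)$ denotes the multiset of items arrived up to time $t$. Communication cost is measured in words of $\Theta(\log n)$ bits, and $n$ is assumed sufficiently large compared with $k$ and $1/\epsilon$. A $\phi$-quantile of $A$ is an $x\in U$ such that at most $\phi|A|$ items of $A$ are smaller than $x$ and at most $(1-\phi)|A|$ items of $A$ are greater than $x$. An $\epsilon$-approximate $\phi$-quantile is any $\phi'$-quantile with $\phi-\epsilon\le\phi'\le\phi+\epsilon$. Tracking means the coordinator holds such an element for $A(t)$ at every time $t$.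
   Formalization: The communication bound is claimed only when an item of U fits in one word of b·Θ(log n) bits (b an arbitrary constant), i.e. u is polynomially bounded in n; without this convention the bound fails for u huge compared with n. *)

theory Defs
  imports Complex_Main "HOL-Library.Multiset" "HOL-Library.Log_Nat"
begin

section \<open>Quantiles\<close>

definition is_quantile :: "nat \<Rightarrow> real \<Rightarrow> nat multiset \<Rightarrow> nat \<Rightarrow> bool" where
  "is_quantile u \<phi> A x \<longleftrightarrow>
     x \<in> {1..u} \<and>
     real (size {#a \<in># A. a < x#}) \<le> \<phi> * real (size A) \<and>
     real (size {#a \<in># A. x < a#}) \<le> (1 - \<phi>) * real (size A)"

definition is_approx_quantile :: "nat \<Rightarrow> real \<Rightarrow> real \<Rightarrow> nat multiset \<Rightarrow> nat \<Rightarrow> bool" where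
  "is_approx_quantile u \<epsilon> \<phi> A x \<longleftrightarrow>
     (\<exists>\<phi>'. \<phi> - \<epsilon> \<le> \<phi>' \<and> \<phi>' \<le> \<phi> + \<epsilon> \<and> is_quantile u \<phi>' A x)"

section \<open>Deterministic protocols with a coordinator\<close>

text \<open>A message is a finite sequence of machine words, each given by its numerical value.\<close>

type_synonym message = "nat list"

text \<open>
  Every reaction is a function of the local state of the reacting party and of the local event:
  an item arriving at a site, a message from the coordinator arriving at a site, or a message from
  a given site arriving at the coordinator. The first component of the result is the new local
  state, the second the messages sent. Sites send to the coordinator only; the coordinator
  addresses each of its messages to one site, so a broadcast consists of \<open>k\<close> messages.
  Only \<open>site_item\<close> is triggered from outside, hence no communication starts without
  the arrival of an item. A site may remember its index, passed to \<open>site_init\<close>.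
\<close>

record ('s, 'c) protocol =
  site_init :: "nat \<Rightarrow> 's"
  site_item :: "'s \<Rightarrow> nat \<Rightarrow> 's \<times> message list"
  site_recv :: "'s \<Rightarrow> message \<Rightarrow> 's \<times> message list"
  coord_init :: "'c"
  coord_recv :: "'c \<Rightarrow> nat \<Rightarrow> message \<Rightarrow> 'c \<times> (nat \<times> message) list"
  coord_answer :: "'c \<Rightarrow> nat"

definition addresses_sites :: "nat \<Rightarrow> ('s, 'c) protocol \<Rightarrow> bool" where
  "addresses_sites k P \<longleftrightarrow>
     (\<forall>c j m. \<forall>(i, m') \<in> set (snd (coord_recv P c j m)). i \<in> {1..k})"

datatype packet =
    Up (site: nat) (payload: message)
  | Down (site: nat) (payload: message)

type_synonym ('s, 'c) config = "(nat \<Rightarrow> 's) \<times> 'c"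

text \<open>
  \<open>exchange P cfg ps tr cfg'\<close>: delivering the messages in flight \<open>ps\<close>, and all messages
  sent in reaction, in first-in first-out order, terminates in \<open>cfg'\<close>; \<open>tr\<close> is the transcript
  of all delivered messages.
\<close>

inductive exchange ::
  "('s, 'c) protocol \<Rightarrow> ('s, 'c) config \<Rightarrow> packet list \<Rightarrow> packet list \<Rightarrow> ('s, 'c) config \<Rightarrow> bool"
  for P where
  quiet: "exchange P cfg [] [] cfg"
| up: "coord_recv P c j m = (c', out) \<Longrightarrow>
       exchange P (ss, c') (ps @ map (\<lambda>(i, m'). Down i m') out) tr cfg' \<Longrightarrow>
       exchange P (ss, c) (Up j m # ps) (Up j m # tr) cfg'"
| down: "site_recv P (ss j) m = (s', out) \<Longrightarrow>
       exchange P (ss(j := s'), c) (ps @ map (Up j) out) tr cfg' \<Longrightarrow>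
       exchange P (ss, c) (Down j m # ps) (Down j m # tr) cfg'"

text \<open>
  A stream is a list of pairs (site, item) in order of arrival. As communication is
  instantaneous, all messages caused by an item are delivered before the next item arrives.
\<close>

type_synonym stream = "(nat \<times> nat) list"

definition streams :: "nat \<Rightarrow> nat \<Rightarrow> stream set" where
  "streams k u = lists ({1..k} \<times> {1..u})"

inductive run ::
  "('s, 'c) protocol \<Rightarrow> stream \<Rightarrow> packet list \<Rightarrow> ('s, 'c) config \<Rightarrow> bool"
  for P where
  start: "run P [] [] (site_init P, coord_init P)"
| arrival: "run P xs tr (ss, c) \<Longrightarrow>
       site_item P (ss j) a = (s', out) \<Longrightarrow>
       exchange P (ss(j := s'), c) (map (Up j) out) tr' cfg' \<Longrightarrow>
       run P (xs @ [(j, a)]) (tr @ tr') cfg'"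

lemma exchange_deterministic:
  "exchange P cfg ps tr1 cfg1 \<Longrightarrow> exchange P cfg ps tr2 cfg2 \<Longrightarrow> tr1 = tr2 \<and> cfg1 = cfg2"
proof (induction arbitrary: tr2 cfg2 rule: exchange.induct)
  case (quiet cfg)
  then show ?case by (auto elim: exchange.cases)
next
  case (up c j m c' out ss ps tr cfg')
  from up.prems show ?case
    by (cases rule: exchange.cases) (use up in auto)
next
  case (down ss j m s' out c ps tr cfg')
  from down.prems show ?case
    by (cases rule: exchange.cases) (use down in auto)
qed

lemma run_deterministic:
  "run P xs tr1 cfg1 \<Longrightarrow> run P xs tr2 cfg2 \<Longrightarrow> tr1 = tr2 \<and> cfg1 = cfg2"
proof (induction arbitrary: tr2 cfg2 rule: run.induct)
  case start
  then show ?case by (auto elim: run.cases)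
next
  case (arrival xs tr ss c j a s' out tr' cfg')
  from arrival.prems obtain tr3 ss3 c3 s3 out3 tr3' where
    r: "run P xs tr3 (ss3, c3)" "site_item P (ss3 j) a = (s3, out3)"
       "exchange P (ss3(j := s3), c3) (map (Up j) out3) tr3' cfg2" "tr2 = tr3 @ tr3'"
    by (auto elim: run.cases)
  from arrival.IH[OF r(1)] have "tr = tr3" "ss = ss3" "c = c3" by auto
  with r arrival.hyps show ?case
    by (auto dest: exchange_deterministic)
qed

section \<open>Tracking and communication cost\<close>

text \<open>Existence of the run says in particular that the communication after each item terminates.\<close>

definition tracks_quantile ::
  "nat \<Rightarrow> nat \<Rightarrow> real \<Rightarrow> real \<Rightarrow> ('s, 'c) protocol \<Rightarrow> bool" where
  "tracks_quantile k u \<epsilon> \<phi> P \<longleftrightarrow>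
     (\<forall>xs \<in> streams k u. \<forall>t \<le> length xs.
        \<exists>tr ss c. run P (take t xs) tr (ss, c) \<and>
          is_approx_quantile u \<epsilon> \<phi> (mset (map snd (take t xs))) (coord_answer P c))"

text \<open>An empty message still signals something, so it is charged as one word.\<close>

definition word_cost :: "packet list \<Rightarrow> nat" where
  "word_cost tr = (\<Sum>p \<leftarrow> tr. max 1 (length (payload p)))"

text \<open>
  Number of bits of a word for streams of length \<open>n\<close>; \<open>floorlog 2 n\<close> is the length of the
  binary representation of \<open>n\<close>, and \<open>b\<close> is the constant hidden in \<open>\<Theta>(log n)\<close>.
\<close>

definition word_size :: "nat \<Rightarrow> nat \<Rightarrow> nat" where
  "word_size b n = b * floorlog 2 n"

definition fits_words :: "nat \<Rightarrow> packet list \<Rightarrow> bool" where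
  "fits_words w tr \<longleftrightarrow> (\<forall>p \<in> set tr. \<forall>v \<in> set (payload p). v < 2 ^ w)"

text \<open>
  \<open>u < 2 ^ w\<close> is the convention implicit in counting words that an item fits in one word.
\<close>

definition cost_at_most ::
  "nat \<Rightarrow> nat \<Rightarrow> nat \<Rightarrow> nat \<Rightarrow> (nat \<Rightarrow> real) \<Rightarrow> ('s, 'c) protocol \<Rightarrow> bool" where
  "cost_at_most b k u N f P \<longleftrightarrow>
     (\<forall>xs \<in> streams k u. \<forall>tr cfg.
        N \<le> length xs \<longrightarrow> u < 2 ^ word_size b (length xs) \<longrightarrow> run P xs tr cfg \<longrightarrow>
          fits_words (word_size b (length xs)) tr \<and> real (word_cost tr) \<le> f (length xs))"

text \<open>
  In existence claims below, local states are taken from \<open>nat\<close>. This loses no generality: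
  a local state is determined by the finite sequence of local events so far, and there are only
  countably many of these.
\<close>

end

theory Submission
  imports Defs "HOL-Library.Countable"
begin

text \<open>
  Let \<open>\<eta> = \<epsilon> / 4\<close>. A site reports whenever its number of items has grown by a factor
  \<open>1 + \<eta>\<close>, and the coordinator recomputes its answer whenever the number of reported items
  has grown by a factor \<open>1 + \<eta>\<close> since the last recomputation, so there are
  \<open>O(log n / \<epsilon>)\<close> recomputations and \<open>O(log n / \<epsilon>)\<close> reports per site. In between, the
  number of items grows by a factor of at most \<open>(1 + \<eta>)\<^sup>2\<close>, which the old answer tolerates.

  A recomputation costs \<open>O(k)\<close> words because the old answer is only \<open>O(\<eta> m)\<close> ranks off,
  where \<open>m\<close> is the number of items. After asking every site for its exact counts relative
  to the old answer, the coordinator performs a \<open>k\<close>-way merge of the local sequences of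
  items beyond the old answer, which only looks at the end of every block of
  \<open>d \<approx> \<eta> m / k\<close> items; \<open>O(k)\<close> block ends suffice to cross \<open>O(\<eta> m)\<close> ranks, and
  the at most \<open>k\<close> partially seen blocks contribute an error of at most \<open>k (d - 1) \<le> \<eta> m\<close>.

  If \<open>\<epsilon> \<ge> 1\<close>, every element of the universe is an admissible answer.
\<close>

section \<open>Protocols with countable local states\<close>

text \<open>The claim asks for local states in \<open>nat\<close>, while the tracker is described
  with lists and datatypes. Since \<open>from_nat\<close> inverts \<open>to_nat\<close>, runs carry
  over with the same transcript and the same answers.\<close>

definition encode_protocol ::
  "('s::countable, 'c::countable) protocol \<Rightarrow> (nat, nat) protocol" where
  "encode_protocol P =
     \<lparr>site_init = \<lambda>i. to_nat (site_init P i),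
      site_item = \<lambda>s a. apfst to_nat (site_item P (from_nat s) a),
      site_recv = \<lambda>s m. apfst to_nat (site_recv P (from_nat s) m),
      coord_init = to_nat (coord_init P),
      coord_recv = \<lambda>c j m. apfst to_nat (coord_recv P (from_nat c) j m),
      coord_answer = \<lambda>c. coord_answer P (from_nat c)\<rparr>"

definition encode_config ::
  "('s::countable, 'c::countable) config \<Rightarrow> (nat, nat) config" where
  "encode_config cfg = (\<lambda>i. to_nat (fst cfg i), to_nat (snd cfg))"

lemma exchange_encode:
  assumes "exchange P cfg ps tr cfg'"
  shows "exchange (encode_protocol P) (encode_config cfg) ps tr (encode_config cfg')"
  using assms
proof induction
  case (quiet cfg)
  show ?case by (rule exchange.quiet)
next
  case (up c j m c' out ss ps tr cfg')
  then show ?case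
    by (auto simp: encode_config_def encode_protocol_def intro!: exchange.up)
next
  case (down ss j m s' out c ps tr cfg')
  have "(\<lambda>i. to_nat ((ss(j := s')) i)) = (\<lambda>i. to_nat (ss i))(j := to_nat s')"
    by auto
  with down show ?case
    by (auto simp: encode_config_def encode_protocol_def intro!: exchange.down)
qed

lemma run_encode:
  assumes "run P xs tr cfg"
  shows "run (encode_protocol P) xs tr (encode_config cfg)"
  using assms
proof induction
  case start
  have "encode_config (site_init P, coord_init P) =
      (site_init (encode_protocol P), coord_init (encode_protocol P))"
    by (simp add: encode_config_def encode_protocol_def)
  then show ?case
    using run.start[of "encode_protocol P"] by simp
next
  case (arrival xs tr ss c j a s' out tr' cfg')
  have *: "encode_config (ss(j := s'), c) = ((\<lambda>i. to_nat (ss i))(j := to_nat s'), to_nat c)"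
    by (auto simp: encode_config_def)
  show ?case
  proof (rule run.arrival)
    show "run (encode_protocol P) xs tr (\<lambda>i. to_nat (ss i), to_nat c)"
      using arrival.IH by (simp add: encode_config_def)
    show "site_item (encode_protocol P) (to_nat (ss j)) a = (to_nat s', out)"
      using arrival.hyps by (simp add: encode_protocol_def)
    show "exchange (encode_protocol P) ((\<lambda>i. to_nat (ss i))(j := to_nat s'), to_nat c)
        (map (Up j) out) tr' (encode_config cfg')"
      using exchange_encode[OF arrival.hyps(3)] by (simp only: *)
  qed
qed

lemma addresses_sites_encode:
  assumes "addresses_sites k P"
  shows "addresses_sites k (encode_protocol P)"
  using assms by (simp add: addresses_sites_def encode_protocol_def apfst_def map_prod_def split_beta)

section \<open>Merging by blocks\<close>

text \<open>The default value \<open>u\<close> is an upper bound of all keys, so it plays the role of infinity.\<close>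

definition block_end :: "nat \<Rightarrow> nat list \<Rightarrow> nat \<Rightarrow> nat \<Rightarrow> nat" where
  "block_end u ks x q = (LEAST v. v = u \<or> q \<le> length (filter (\<lambda>a. x < a \<and> a \<le> v) ks))"

lemma block_end_le: "block_end u ks x q \<le> u"
  unfolding block_end_def by (rule Least_le) simp

lemma block_end_cases:
  "block_end u ks x q = u \<or> q \<le> length (filter (\<lambda>a. x < a \<and> a \<le> block_end u ks x q) ks)"
  unfolding block_end_def by (rule LeastI[where k = u]) simp

lemma block_end_greater:
  assumes "x < u" "0 < q"
  shows "x < block_end u ks x q"
proof (rule ccontr)
  assume "\<not> ?thesis"
  then have "filter (\<lambda>a. x < a \<and> a \<le> block_end u ks x q) ks = []"
    by (auto simp: filter_empty_conv)
  with block_end_cases[of u ks x q] assms \<open>\<not> ?thesis\<close> show False by auto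
qed

text \<open>The predecessor of the least admissible value is not admissible. Because of repeated
  keys the count up to and including the block end may exceed \<open>q\<close>; only the strict
  count has an upper bound.\<close>

lemma count_below_block_end:
  assumes "0 < q"
  shows "length (filter (\<lambda>a. x < a \<and> a < block_end u ks x q) ks) < q"
proof (cases "block_end u ks x q")
  case 0
  then show ?thesis using assms by simp
next
  case (Suc v)
  then have "\<not> (v = u \<or> q \<le> length (filter (\<lambda>a. x < a \<and> a \<le> v) ks))"
    unfolding block_end_def by (intro not_less_Least) simp
  with Suc show ?thesis by (simp add: less_Suc_eq_le)
qed

lemma block_end_mono:
  assumes "q \<le> q'"
  shows "block_end u ks x q \<le> block_end u ks x q'"
proof -
  have "block_end u ks x q' = u \<or>
      q \<le> length (filter (\<lambda>a. x < a \<and> a \<le> block_end u ks x q') ks)"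
    using block_end_cases[of u ks x q'] assms by linarith
  then show ?thesis
    unfolding block_end_def[of u ks x q] by (rule Least_le)
qed

definition requests :: "(nat \<times> nat) list \<Rightarrow> nat \<Rightarrow> nat" where
  "requests lg j = length (filter (\<lambda>e. fst e = j) lg)"

definition current :: "nat \<Rightarrow> (nat \<times> nat) list \<Rightarrow> nat \<Rightarrow> nat" where
  "current x lg j = (case map_of lg j of None \<Rightarrow> x | Some v \<Rightarrow> v)"

definition next_site :: "nat \<Rightarrow> nat \<Rightarrow> (nat \<times> nat) list \<Rightarrow> nat" where
  "next_site k x lg = arg_min_on (current x lg) {1..k}"

text \<open>The merge as a pure recursion, separated from the messages that carry it out: the next
  block is always taken from a site whose last known block end is least. With the latest reply
  first, \<open>map_of\<close> in \<open>current\<close> finds exactly that last block end.\<close>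

primrec merge_log ::
  "nat \<Rightarrow> nat \<Rightarrow> (nat \<Rightarrow> nat list) \<Rightarrow> nat \<Rightarrow> nat \<Rightarrow> nat \<Rightarrow> (nat \<times> nat) list" where
  "merge_log k u B x d 0 = []"
| "merge_log k u B x d (Suc n) =
     (let lg = merge_log k u B x d n; j = next_site k x lg
      in (j, block_end u (B j) x ((requests lg j + 1) * d)) # lg)"

lemma length_merge_log [simp]: "length (merge_log k u B x d n) = n"
  by (induction n) (auto simp: Let_def)

lemma requests_Cons [simp]:
  "requests ((i, v) # lg) j = (if i = j then requests lg j + 1 else requests lg j)"
  by (simp add: requests_def)

lemma current_Cons [simp]: "current x ((i, v) # lg) j = (if i = j then v else current x lg j)"
  by (simp add: current_def)

lemma requests_Nil [simp]: "requests [] j = 0"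
  by (simp add: requests_def)

lemma current_Nil [simp]: "current x [] j = x"
  by (simp add: current_def)

lemma requests_le: "requests lg j \<le> length lg"
  by (simp add: requests_def)

lemma next_site_in: "1 \<le> k \<Longrightarrow> next_site k x lg \<in> {1..k}"
  unfolding next_site_def by (rule arg_min_if_finite) auto

lemma current_next_site_le:
  "j \<in> {1..k} \<Longrightarrow> current x lg (next_site k x lg) \<le> current x lg j"
  unfolding next_site_def
  by (metis arg_min_if_finite(2) empty_iff finite_atLeastAtMost not_le_imp_less)

text \<open>A site that has not replied yet stands at the start \<open>x\<close>, whereas
  \<open>block_end\<close> for \<open>q = 0\<close> would be \<open>0\<close>; hence the separate
  case.\<close>

definition nth_block_end :: "nat \<Rightarrow> (nat \<Rightarrow> nat list) \<Rightarrow> nat \<Rightarrow> nat \<Rightarrow> nat \<Rightarrow> nat \<Rightarrow> nat" where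
  "nth_block_end u B x d j p = (if p = 0 then x else block_end u (B j) x (p * d))"

lemma nth_block_end_mono:
  assumes "x < u" "0 < d" "p \<le> p'"
  shows "nth_block_end u B x d j p \<le> nth_block_end u B x d j p'"
  using assms block_end_greater[of x u "p' * d" "B j"]
  by (auto simp: nth_block_end_def intro: block_end_mono less_imp_le)

lemma current_merge_log:
  "current x (merge_log k u B x d n) j =
     nth_block_end u B x d j (requests (merge_log k u B x d n) j)"
proof (induction n)
  case 0
  then show ?case by (simp add: nth_block_end_def)
next
  case (Suc n)
  then show ?case
    by (auto simp: Let_def nth_block_end_def)
qed

text \<open>When site \<open>j\<close> was last asked, its block end at that moment was the least of
  all. Current block ends never decrease, so that value stays below the current block ends of all
  sites.\<close>

lemma merge_log_order:
  assumes "x < u" "0 < d"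
  assumes "i \<in> {1..k}" "j \<in> {1..k}" "0 < requests (merge_log k u B x d n) j"
  shows "nth_block_end u B x d j (requests (merge_log k u B x d n) j - 1)
    \<le> current x (merge_log k u B x d n) i"
  using assms(3-5)
proof (induction n arbitrary: i j)
  case 0
  then show ?case by simp
next
  case (Suc n)
  define lg where "lg = merge_log k u B x d n"
  define m where "m = next_site k x lg"
  have lg': "merge_log k u B x d (Suc n) =
      (m, block_end u (B m) x ((requests lg m + 1) * d)) # lg"
    by (simp add: Let_def lg_def m_def)
  have k: "1 \<le> k" using Suc.prems by auto
  have cur: "current x lg i = nth_block_end u B x d i (requests lg i)" for i
    unfolding lg_def by (rule current_merge_log)
  have mono: "current x lg i \<le> current x (merge_log k u B x d (Suc n)) i" for i
  proof (cases "i = m")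
    case True
    have "nth_block_end u B x d m (requests lg m) \<le> nth_block_end u B x d m (requests lg m + 1)"
      by (rule nth_block_end_mono) (use assms in auto)
    with True show ?thesis
      unfolding lg' cur by (simp add: nth_block_end_def)
  next
    case False
    then show ?thesis unfolding lg' by simp
  qed
  show ?case
  proof (cases "j = m")
    case True
    have "nth_block_end u B x d j (requests lg j) \<le> current x lg i"
      using current_next_site_le[OF Suc.prems(1), of x lg] True cur by (simp add: m_def)
    also note mono
    finally show ?thesis using True unfolding lg' by simp
  next
    case False
    then have "0 < requests lg j" using Suc.prems unfolding lg' by simp
    from Suc.IH[OF Suc.prems(1,2) this[unfolded lg_def]]
    have "nth_block_end u B x d j (requests lg j - 1) \<le> current x lg i"
      unfolding lg_def .
    also note mono
    finally show ?thesis using False unfolding lg' by simp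
  qed
qed

lemma sum_requests_merge_log:
  assumes "1 \<le> k"
  shows "(\<Sum>j\<in>{1..k}. requests (merge_log k u B x d n) j) = n"
proof (induction n)
  case 0
  then show ?case by simp
next
  case (Suc n)
  define lg where "lg = merge_log k u B x d n"
  have *: "requests (merge_log k u B x d (Suc n)) j =
      requests lg j + (if next_site k x lg = j then 1 else 0)" for j
    by (simp add: Let_def lg_def)
  show ?case
    unfolding * sum.distrib using Suc next_site_in[OF assms, of x lg]
    by (simp add: lg_def)
qed

text \<open>An unasked site still stands at \<open>x\<close>. A second request to another site would
  need that site's first block end to be at most \<open>x\<close>, but block ends exceed
  \<open>x\<close>. So every other site was asked at most once, which makes fewer than
  \<open>k\<close> requests.\<close>

lemma requests_merge_log_pos:
  assumes "x < u" "0 < d" "k \<le> n" "j \<in> {1..k}"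
  shows "0 < requests (merge_log k u B x d n) j"
proof (rule ccontr)
  define lg where "lg = merge_log k u B x d n"
  assume "\<not> ?thesis"
  then have j0: "requests lg j = 0" by (simp add: lg_def)
  then have cj: "current x lg j = x"
    by (simp add: lg_def current_merge_log nth_block_end_def)
  have le1: "requests lg i \<le> 1" if "i \<in> {1..k}" for i
  proof (rule ccontr)
    assume "\<not> ?thesis"
    then have "1 \<le> requests lg i - 1" "0 < requests lg i" by auto
    then have "nth_block_end u B x d i 1 \<le> x"
      using merge_log_order[OF assms(1,2,4) that, of B n]
        nth_block_end_mono[OF assms(1,2), of 1 "requests lg i - 1" B i] cj
      by (auto simp: lg_def)
    then show False
      using block_end_greater[OF assms(1,2), of "B i"] by (simp add: nth_block_end_def)
  qed
  have "n = (\<Sum>i\<in>{1..k}. requests lg i)"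
    using assms unfolding lg_def by (subst sum_requests_merge_log) auto
  also have "\<dots> = (\<Sum>i\<in>{1..k} - {j}. requests lg i)"
    using assms j0 by (simp add: sum.remove)
  also have "\<dots> \<le> (\<Sum>i\<in>{1..k} - {j}. 1)"
    by (rule sum_mono) (use le1 in auto)
  also have "\<dots> < k" using assms by simp
  finally show False using assms by simp
qed

text \<open>\<open>y\<close> is the least current block end. Strictly below it each site has at most
  \<open>p j * d - 1\<close> keys beyond \<open>x\<close>, which sums to the upper bound. Up to
  \<open>y\<close> all requested blocks are complete except possibly the last one of each of the
  other \<open>k - 1\<close> sites, so \<open>K + k - 1\<close> requests guarantee \<open>K\<close>
  full blocks.\<close>

lemma merge_bounds:
  fixes B :: "nat \<Rightarrow> nat list"
  assumes "x < u" "0 < d" "1 \<le> k" "1 \<le> K"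
  defines "lg \<equiv> merge_log k u B x d (K + k - 1)"
  defines "y \<equiv> current x lg (next_site k x lg)"
  shows "x < y" "y \<le> u"
    and "(\<Sum>j\<in>{1..k}. length (filter (\<lambda>a. x < a \<and> a < y) (B j))) + k \<le> (K + k - 1) * d"
    and "y < u \<Longrightarrow> K * d \<le> (\<Sum>j\<in>{1..k}. length (filter (\<lambda>a. x < a \<and> a \<le> y) (B j)))"
proof -
  define p where "p = requests lg"
  define m where "m = next_site k x lg"
  have m: "m \<in> {1..k}" unfolding m_def using next_site_in assms by blast
  have pos: "0 < p j" if "j \<in> {1..k}" for j
    unfolding p_def lg_def using assms that by (intro requests_merge_log_pos) auto
  have cur: "current x lg j = block_end u (B j) x (p j * d)" if "j \<in> {1..k}" for j
    using pos[OF that] unfolding p_def lg_def current_merge_log by (simp add: nth_block_end_def)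
  have y: "y = block_end u (B m) x (p m * d)"
    unfolding y_def using cur m by (simp add: m_def)
  show "x < y" unfolding y using block_end_greater assms pos m by simp
  show "y \<le> u" unfolding y by (rule block_end_le)
  have sum: "(\<Sum>j\<in>{1..k}. p j) = K + k - 1"
    unfolding p_def lg_def using assms by (intro sum_requests_merge_log)
  have "(\<Sum>j\<in>{1..k}. length (filter (\<lambda>a. x < a \<and> a < y) (B j)) + 1)
    \<le> (\<Sum>j\<in>{1..k}. p j * d)"
  proof (rule sum_mono)
    fix j assume j: "j \<in> {1..k}"
    have "y \<le> block_end u (B j) x (p j * d)"
      using current_next_site_le[OF j, of x lg] cur[OF j] by (simp add: y_def)
    then have "length (filter (\<lambda>a. x < a \<and> a < y) (B j))
        \<le> length (filter (\<lambda>a. x < a \<and> a < block_end u (B j) x (p j * d)) (B j))"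
      by (subst (1 2) length_filter_conv_card, intro card_mono) auto
    also have "\<dots> < p j * d"
      using count_below_block_end pos[OF j] assms by simp
    finally show "length (filter (\<lambda>a. x < a \<and> a < y) (B j)) + 1 \<le> p j * d" by simp
  qed
  also have "\<dots> = (K + k - 1) * d"
    by (simp only: sum_distrib_right[symmetric] sum)
  finally show "(\<Sum>j\<in>{1..k}. length (filter (\<lambda>a. x < a \<and> a < y) (B j))) + k \<le> (K + k - 1) * d"
    by (simp add: sum_Suc)
  \<comment> \<open>Below the default value \<open>u\<close>, a block end really has its full quota
    of keys up to it.\<close>
  assume "y < u"
  have "(K + k - 1) * d = (\<Sum>j\<in>{1..k}. p j * d)"
    by (simp only: sum_distrib_right[symmetric] sum)
  \<comment> \<open>The last block of site \<open>m\<close> ends at \<open>y\<close> itself and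
    counts fully; every other site is allowed to lose one block of \<open>d\<close> keys. Its last
    but one block ends at or before \<open>y\<close> by \<open>merge_log_order\<close>.\<close>
  also have "\<dots> \<le> (\<Sum>j\<in>{1..k}. length (filter (\<lambda>a. x < a \<and> a \<le> y) (B j)) +
      (if j = m then 0 else d))"
  proof (rule sum_mono)
    fix j assume j: "j \<in> {1..k}"
    show "p j * d \<le> length (filter (\<lambda>a. x < a \<and> a \<le> y) (B j)) + (if j = m then 0 else d)"
    proof (cases "j = m")
      case True
      then show ?thesis using block_end_cases[of u "B m" x "p m * d"] \<open>y < u\<close> y by simp
    next
      case False
      show ?thesis
      proof (cases "p j = 1")
        case True
        then show ?thesis using False by simp
      next
        case p: False
        then obtain r where r: "p j = Suc r" "0 < r" using pos[OF j]
          by (metis One_nat_def Suc_pred neq0_conv)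
        have le: "block_end u (B j) x (r * d) \<le> y"
          using merge_log_order[OF assms(1,2) m j, of B "K + k - 1", folded lg_def p_def] pos[OF j] r
          by (simp add: y_def nth_block_end_def m_def)
        then have "r * d \<le> length (filter (\<lambda>a. x < a \<and> a \<le> block_end u (B j) x (r * d)) (B j))"
          using block_end_cases[of u "B j" x "r * d"] \<open>y < u\<close> by simp
        also have "\<dots> \<le> length (filter (\<lambda>a. x < a \<and> a \<le> y) (B j))"
          using le by (subst (1 2) length_filter_conv_card, intro card_mono) auto
        finally show ?thesis using False r by simp
      qed
    qed
  qed
  also have "\<dots> = (\<Sum>j\<in>{1..k}. length (filter (\<lambda>a. x < a \<and> a \<le> y) (B j))) + (k - 1) * d"
  proof -
    have "(\<Sum>j\<in>{1..k}. if j = m then 0 else d) = (\<Sum>j\<in>{1..k} - {m}. d)"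
      using m by (subst sum.remove[of _ m]) auto
    then show ?thesis unfolding sum.distrib using m by simp
  qed
  finally show "K * d \<le> (\<Sum>j\<in>{1..k}. length (filter (\<lambda>a. x < a \<and> a \<le> y) (B j)))"
    using assms by (cases k) (auto simp: algebra_simps)
qed

section \<open>Single message deliveries, and the measures of a transcript\<close>

lemma exchange_up:
  assumes "coord_recv P c j m = (c', out)"
    and "exchange P (ss, c') (map (\<lambda>(i, m'). Down i m') out) tr cfg'"
  shows "exchange P (ss, c) [Up j m] (Up j m # tr) cfg'"
  using exchange.up[OF assms(1), of ss "[]" tr cfg'] assms(2) by simp

lemma exchange_query:
  assumes "site_recv P (ss i) q = (ss i, [r])"
    and "exchange P (ss, c) [Up i r] tr cfg'"
  shows "exchange P (ss, c) [Down i q] (Down i q # tr) cfg'"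
  using exchange.down[of P ss i q "ss i" "[r]" c "[]" tr cfg'] assms by simp

lemma word_cost_Nil [simp]: "word_cost [] = 0"
  by (simp add: word_cost_def)

lemma word_cost_Cons [simp]: "word_cost (p # tr) = max 1 (length (payload p)) + word_cost tr"
  by (simp add: word_cost_def)

lemma word_cost_append [simp]: "word_cost (tr @ tr') = word_cost tr + word_cost tr'"
  by (simp add: word_cost_def)

text \<open>A bound on values is independent of the constant \<open>b\<close> and can be maintained
  along the stream; it is converted into a number of bits only at the end.\<close>

definition bounded_words :: "nat \<Rightarrow> packet list \<Rightarrow> bool" where
  "bounded_words w tr \<longleftrightarrow> (\<forall>p \<in> set tr. \<forall>v \<in> set (payload p). v \<le> w)"

lemma bounded_words_Nil [simp]: "bounded_words w []"
  by (simp add: bounded_words_def)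

lemma bounded_words_Cons [simp]:
  "bounded_words w (p # tr) \<longleftrightarrow> (\<forall>v \<in> set (payload p). v \<le> w) \<and> bounded_words w tr"
  by (auto simp: bounded_words_def)

lemma bounded_words_append [simp]:
  "bounded_words w (tr @ tr') \<longleftrightarrow> bounded_words w tr \<and> bounded_words w tr'"
  by (auto simp: bounded_words_def)

lemma bounded_words_mono: "bounded_words w tr \<Longrightarrow> w \<le> w' \<Longrightarrow> bounded_words w' tr"
  by (fastforce simp: bounded_words_def)

section \<open>The tracking protocol\<close>

text \<open>
  Keys turn items into numbers below \<open>u\<close>, increasing in direction \<open>0\<close> and decreasing in
  direction \<open>1\<close>, so that moving the answer to either side is a move to larger keys.
\<close>

definition key :: "nat \<Rightarrow> nat \<Rightarrow> nat \<Rightarrow> nat" where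
  "key u dir a = (if dir = 0 then a - 1 else u - a)"

definition unkey :: "nat \<Rightarrow> nat \<Rightarrow> nat \<Rightarrow> nat" where
  "unkey u dir v = (if dir = 0 then v + 1 else u - v)"

text \<open>
  \<open>Poll i M L Q\<close>: waiting for the counts of site \<open>i\<close>, with the totals so far of all items,
  of those below the old answer, and of those not above it.
  \<open>Merge dir d S lg\<close>: \<open>S\<close> block ends are to be requested in total, for blocks of \<open>d\<close> items;
  the log lists the replies, latest first, with the sites they came from.
\<close>

datatype phase =
    Idle
  | Poll nat nat nat nat
  | Merge nat nat nat "(nat \<times> nat) list"

instance phase :: countable
  by countable_datatype

text \<open>
  The components are the answer, the number of items at the last recomputation and the sum of
  the reported counts. While the merge runs, the second component is already the new number.
\<close>

type_synonym coord_state = "nat \<times> nat \<times> nat \<times> phase"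

text \<open>The second component is the last reported number of items.\<close>

type_synonym site_state = "nat list \<times> nat"

locale quantile_tracking =
  fixes k u :: nat and \<eta> \<phi> :: real
  assumes k: "2 \<le> k" and u: "1 \<le> u"
    and eta: "0 < \<eta>" "\<eta> \<le> 1 / 4" and phi: "0 \<le> \<phi>" "\<phi> \<le> 1"
begin

definition block_length :: "nat \<Rightarrow> nat" where
  "block_length M = nat \<lfloor>\<eta> * M / k\<rfloor> + 1"

text \<open>The number of blocks that lift the rank from \<open>Q\<close> to the target
  \<open>(\<psi> - \<eta>) * M\<close>. Aiming \<open>\<eta> * M\<close> too low leaves room for the
  overshoot of the merge. A target already reached gives a nonpositive quotient, which
  \<open>nat\<close> turns into \<open>0\<close>.\<close>

definition blocks_needed :: "real \<Rightarrow> nat \<Rightarrow> nat \<Rightarrow> nat" where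
  "blocks_needed \<psi> M Q = nat \<lceil>(\<psi> * M - \<eta> * M - Q) / block_length M\<rceil>"

definition merge_step ::
  "nat \<Rightarrow> nat \<Rightarrow> nat \<Rightarrow> nat \<Rightarrow> nat \<Rightarrow> nat \<Rightarrow> (nat \<times> nat) list \<Rightarrow>
   coord_state \<times> (nat \<times> message) list" where
  "merge_step x M R dir d S lg =
     (let j = next_site k (key u dir x) lg in
      if length lg < S
      then ((x, M, R, Merge dir d S lg), [(j, [dir, key u dir x, requests lg j + 1, d])])
      else ((unkey u dir (current (key u dir x) lg j), M, R, Idle), []))"

text \<open>A positive \<open>K0\<close> means too few items not above \<open>x\<close>, so the
  answer moves up. Otherwise \<open>K1\<close> measures the mirrored deficit: \<open>M - L\<close>
  items are at least \<open>x\<close>, and the target is that of \<open>1 - \<phi>\<close>. If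
  neither is positive, no block is requested and \<open>x\<close> is kept.\<close>

definition start_merge ::
  "nat \<Rightarrow> nat \<Rightarrow> nat \<Rightarrow> nat \<Rightarrow> nat \<Rightarrow> coord_state \<times> (nat \<times> message) list" where
  "start_merge x M R L Q =
     (let K0 = blocks_needed \<phi> M Q; K1 = blocks_needed (1 - \<phi>) M (M - L);
          dir = (if 0 < K0 then 0 else 1); K = (if 0 < K0 then K0 else K1)
      in merge_step x M R dir (block_length M) (if K = 0 then 0 else K + k - 1) [])"

fun coordinator :: "coord_state \<Rightarrow> nat \<Rightarrow> message \<Rightarrow> coord_state \<times> (nat \<times> message) list" where
  "coordinator (x, m0, R, Idle) j m =
     (let R' = R + hd m in
      if real R' > (1 + \<eta>) * m0 then ((x, m0, R', Poll 1 0 0 0), [(1, [x])])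
      else ((x, m0, R', Idle), []))"
| "coordinator (x, m0, R, Poll i M L Q) j m =
     (let M' = M + m ! 0; L' = L + m ! 1; Q' = Q + m ! 2 in
      if i < k then ((x, m0, R, Poll (i + 1) M' L' Q'), [(i + 1, [x])])
      else start_merge x M' R L' Q')"
| "coordinator (x, m0, R, Merge dir d S lg) j m = merge_step x m0 R dir d S ((j, hd m) # lg)"

text \<open>Requests carry all parameters, so a site stores nothing about a running poll or merge.
  Polls have one word and block requests four, so the length tells them apart.\<close>

definition answer :: "nat list \<Rightarrow> message \<Rightarrow> message" where
  "answer as q =
     (if length q = 1
      then [length as, length (filter (\<lambda>a. a < q ! 0) as), length (filter (\<lambda>a. a \<le> q ! 0) as)]
      else [block_end u (map (key u (q ! 0)) as) (q ! 1) (q ! 2 * q ! 3)])"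

text \<open>Reporting increments lets the coordinator maintain the sum of all reported counts
  without remembering them per site.\<close>

definition item_arrives :: "site_state \<Rightarrow> nat \<Rightarrow> site_state \<times> message list" where
  "item_arrives s a =
     (let as = a # fst s; r = snd s in
      if real (length as) > (1 + \<eta>) * r then ((as, length as), [[length as - r]])
      else ((as, r), []))"

definition tracker :: "(site_state, coord_state) protocol" where
  "tracker =
     \<lparr>site_init = \<lambda>i. ([], 0),
      site_item = item_arrives,
      site_recv = \<lambda>s q. (s, [answer (fst s) q]),
      coord_init = (1, 0, 0, Idle),
      coord_recv = coordinator,
      coord_answer = fst\<rparr>"

lemma tracker_simps [simp]:
  "site_init tracker = (\<lambda>i. ([], 0))"
  "site_item tracker = item_arrives"
  "site_recv tracker = (\<lambda>s q. (s, [answer (fst s) q]))"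
  "coord_init tracker = (1, 0, 0, Idle)"
  "coord_recv tracker = coordinator"
  "coord_answer tracker = fst"
  by (simp_all add: tracker_def)

lemma k_pos [simp]: "1 \<le> k" "Suc 0 \<le> k" "0 < k"
  using k by auto

lemma merge_step_addresses:
  "\<forall>(i, m') \<in> set (snd (merge_step x M R dir d S lg)). i \<in> {1..k}"
  using next_site_in[of k "key u dir x" lg] by (auto simp: merge_step_def Let_def)

lemma addresses_sites_tracker: "addresses_sites k tracker"
proof -
  have "\<forall>(i, m') \<in> set (snd (coordinator c j m)). i \<in> {1..k}" for c j m
  proof -
    obtain x m0 R ph where c: "c = (x, m0, R, ph)" by (cases c)
    show ?thesis
    proof (cases ph)
      case Idle
      then show ?thesis by (auto simp: c Let_def)
    next
      case (Poll i M L Q)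
      show ?thesis
      proof (cases "i < k")
        case True
        then show ?thesis by (simp add: c Poll Let_def)
      next
        case False
        then show ?thesis
          using merge_step_addresses by (simp add: c Poll Let_def start_merge_def)
      qed
    next
      case (Merge dir d S lg)
      then show ?thesis using merge_step_addresses by (simp only: c coordinator.simps)
    qed
  qed
  then show ?thesis by (simp add: addresses_sites_def)
qed

section \<open>Message exchanges of a poll and of a merge\<close>

definition tally :: "(nat \<Rightarrow> site_state) \<Rightarrow> (nat \<Rightarrow> bool) \<Rightarrow> nat" where
  "tally ss P = (\<Sum>j\<in>{1..k}. length (filter P (fst (ss j))))"

text \<open>Induction from the last site backwards; \<open>s i\<close> are the totals over the sites
  polled before \<open>i\<close>, and \<open>tr\<close> is the transcript of the merge that follows
  the poll. Each site costs one word down and three up, hence the factor \<open>4\<close>.\<close>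

lemma poll_exchange:
  fixes ss :: "nat \<Rightarrow> site_state"
  defines "s i P \<equiv> (\<Sum>j\<in>{1..<i}. length (filter P (fst (ss j))))"
  assumes "start_merge x (tally ss (\<lambda>_. True)) R (tally ss (\<lambda>a. a < x)) (tally ss (\<lambda>a. a \<le> x)) = (c', out)"
    and "exchange tracker (ss, c') (map (\<lambda>(i, m'). Down i m') out) tr cfg'"
    and "bounded_words w tr" "tally ss (\<lambda>_. True) \<le> w" "x \<le> w"
    and "1 \<le> i" "i \<le> k"
  shows "\<exists>tr'. exchange tracker
      (ss, (x, m0, R, Poll i (s i (\<lambda>_. True)) (s i (\<lambda>a. a < x)) (s i (\<lambda>a. a \<le> x))))
      [Down i [x]] tr' cfg' \<and> word_cost tr' = 4 * (k + 1 - i) + word_cost tr \<and> bounded_words w tr'"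
  using assms(8,7)
proof (induction i rule: inc_induct)
  case base
  define r where "r = answer (fst (ss k)) [x]"
  have s: "s k P + length (filter P (fst (ss k))) = tally ss P" for P
  proof -
    have "{1..k} = insert k {1..<k}" by auto
    then show ?thesis by (simp add: s_def tally_def)
  qed
  have c: "coordinator (x, m0, R, Poll k (s k (\<lambda>_. True)) (s k (\<lambda>a. a < x)) (s k (\<lambda>a. a \<le> x))) k r
      = (c', out)"
    using assms(2) s[of "\<lambda>_. True"] s[of "\<lambda>a. a < x"] s[of "\<lambda>a. a \<le> x"]
    by (simp add: r_def answer_def)
  have le: "length (filter P (fst (ss k))) \<le> w" for P
    by (rule order_trans[OF length_filter_le]) (use s[of "\<lambda>_. True"] assms(5) in simp)
  have ex: "exchange tracker
      (ss, (x, m0, R, Poll k (s k (\<lambda>_. True)) (s k (\<lambda>a. a < x)) (s k (\<lambda>a. a \<le> x))))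
      [Down k [x]] (Down k [x] # Up k r # tr) cfg'"
    by (rule exchange_query[where r = r], simp add: r_def, rule exchange_up[where c' = c' and out = out])
      (use c assms(3) in simp_all)
  have "bounded_words w (Down k [x] # Up k r # tr)"
    using assms(4,6) le[of "\<lambda>_. True"] le[of "\<lambda>a. a < x"] le[of "\<lambda>a. a \<le> x"]
    by (simp add: r_def answer_def)
  moreover have "word_cost (Down k [x] # Up k r # tr) = 4 * (k + 1 - k) + word_cost tr"
    by (simp add: r_def answer_def)
  ultimately show ?case using ex by blast
next
  case (step i)
  define r where "r = answer (fst (ss i)) [x]"
  have s: "s i P + length (filter P (fst (ss i))) = s (Suc i) P" for P
    using step.prems by (simp add: s_def)
  have c: "coordinator (x, m0, R, Poll i (s i (\<lambda>_. True)) (s i (\<lambda>a. a < x)) (s i (\<lambda>a. a \<le> x))) i r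
      = ((x, m0, R, Poll (Suc i) (s (Suc i) (\<lambda>_. True)) (s (Suc i) (\<lambda>a. a < x)) (s (Suc i) (\<lambda>a. a \<le> x))),
         [(Suc i, [x])])"
    using step.hyps s[of "\<lambda>_. True"] s[of "\<lambda>a. a < x"] s[of "\<lambda>a. a \<le> x"]
    by (simp add: r_def answer_def)
  obtain tr' where tr': "exchange tracker
      (ss, (x, m0, R, Poll (Suc i) (s (Suc i) (\<lambda>_. True)) (s (Suc i) (\<lambda>a. a < x)) (s (Suc i) (\<lambda>a. a \<le> x))))
      [Down (Suc i) [x]] tr' cfg'" "word_cost tr' = 4 * (k + 1 - Suc i) + word_cost tr"
      "bounded_words w tr'"
    using step by auto
  have ex: "exchange tracker
      (ss, (x, m0, R, Poll i (s i (\<lambda>_. True)) (s i (\<lambda>a. a < x)) (s i (\<lambda>a. a \<le> x))))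
      [Down i [x]] (Down i [x] # Up i r # tr') cfg'"
    by (rule exchange_query[where r = r], simp add: r_def,
        rule exchange_up[OF c[folded tracker_simps(5)]]) (use tr' in simp)
  have "length (filter (\<lambda>_. True) (fst (ss i))) \<le> tally ss (\<lambda>_. True)"
    unfolding tally_def using step.hyps step.prems by (intro member_le_sum) auto
  then have le: "length (filter P (fst (ss i))) \<le> w" for P
    using assms(5) by (intro order_trans[OF length_filter_le]) simp
  have "bounded_words w (Down i [x] # Up i r # tr')"
    using tr' assms(6) le[of "\<lambda>_. True"] le[of "\<lambda>a. a < x"] le[of "\<lambda>a. a \<le> x"]
    by (simp add: r_def answer_def)
  moreover have "word_cost (Down i [x] # Up i r # tr') = 4 * (k + 1 - i) + word_cost tr"
    using tr' step.hyps by (simp add: r_def answer_def Suc_diff_le)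
  ultimately show ?case using ex by blast
qed

text \<open>The coordinator's log is always a prefix stage of \<open>merge_log\<close>, because each
  reply is the entry that the recursion would add. Backward induction from \<open>S\<close> to
  \<open>n\<close>; a request has four words and its reply one, hence the factor
  \<open>5\<close>.\<close>

lemma merge_exchange:
  fixes ss :: "nat \<Rightarrow> site_state" and x dir d :: nat
  defines "B \<equiv> \<lambda>j. map (key u dir) (fst (ss j))"
  defines "lg n \<equiv> merge_log k u B (key u dir x) d n"
  assumes "S \<le> w" "d \<le> w" "u \<le> w" "dir \<le> w" "key u dir x \<le> w"
    and "n \<le> S" "merge_step x M R dir d S (lg n) = (c, out)"
  shows "\<exists>tr. exchange tracker (ss, c) (map (\<lambda>(i, m'). Down i m') out) tr
      (ss, (unkey u dir (current (key u dir x) (lg S) (next_site k (key u dir x) (lg S))), M, R, Idle))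
    \<and> word_cost tr = 5 * (S - n) \<and> bounded_words w tr"
  using assms(8,9)
proof (induction n arbitrary: c out rule: inc_induct)
  case base
  then show ?case
    by (auto simp: merge_step_def Let_def lg_def intro: exchange.quiet exI[of _ "[]"])
next
  case (step n)
  define x' where "x' = key u dir x"
  define j where "j = next_site k x' (lg n)"
  define q where "q = [dir, x', requests (lg n) j + 1, d]"
  define r where "r = answer (fst (ss j)) q"
  have co: "c = (x, M, R, Merge dir d S (lg n))" "out = [(j, q)]"
    using step.prems step.hyps by (auto simp: merge_step_def Let_def lg_def j_def q_def x'_def)
  have r: "r = [block_end u (B j) x' ((requests (lg n) j + 1) * d)]"
    by (simp add: r_def answer_def q_def B_def)
  have lg: "(j, hd r) # lg n = lg (Suc n)"
    unfolding r by (simp add: lg_def j_def x'_def Let_def)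
  obtain c' out' where co': "merge_step x M R dir d S (lg (Suc n)) = (c', out')"
    by fastforce
  from step.IH[OF this] obtain tr where tr: "exchange tracker (ss, c') (map (\<lambda>(i, m'). Down i m') out') tr
      (ss, (unkey u dir (current (key u dir x) (lg S) (next_site k (key u dir x) (lg S))), M, R, Idle))"
    "word_cost tr = 5 * (S - Suc n)" "bounded_words w tr"
    by blast
  have "exchange tracker (ss, c) [Down j q] (Down j q # Up j r # tr)
      (ss, (unkey u dir (current (key u dir x) (lg S) (next_site k (key u dir x) (lg S))), M, R, Idle))"
    by (rule exchange_query[where r = r], simp add: r_def, rule exchange_up)
      (use tr co' in \<open>simp_all add: co lg\<close>)
  moreover have "requests (lg n) j < w"
    using requests_le[of "lg n" j] step.hyps assms(3) by (simp add: lg_def)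
  then have "bounded_words w (Down j q # Up j r # tr)"
    using tr assms block_end_le[of u "B j" x' "(requests (lg n) j + 1) * d"]
    by (simp add: r q_def x'_def)
  moreover have "word_cost (Down j q # Up j r # tr) = 5 * (S - n)"
    using tr step.hyps by (simp add: r q_def)
  ultimately show ?case by (auto simp: co)
qed

section \<open>Block sizes, accuracy of a merge, and a complete recomputation\<close>

lemma block_length_bounds:
  "k * (real (block_length M) - 1) \<le> \<eta> * M" "\<eta> * M \<le> k * real (block_length M)"
  "1 \<le> block_length M"
proof -
  have "0 \<le> \<eta> * M / k" using eta by simp
  then have eq: "real (block_length M) = real_of_int \<lfloor>\<eta> * M / k\<rfloor> + 1"
    unfolding block_length_def by simp
  have "k * real_of_int \<lfloor>\<eta> * M / k\<rfloor> \<le> k * (\<eta> * M / k)"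
    by (intro mult_left_mono) auto
  then show "k * (real (block_length M) - 1) \<le> \<eta> * M"
    using k by (simp add: eq)
  have "\<eta> * M / k \<le> real (block_length M)" unfolding eq by linarith
  then show "\<eta> * M \<le> k * real (block_length M)"
    using k by (simp add: pos_divide_le_eq mult.commute)
  show "1 \<le> block_length M" by (simp add: block_length_def)
qed

text \<open>Block lengths are sent as words, so they must not exceed the number of items. Here
  \<open>2 \<le> k\<close> and \<open>\<eta> \<le> 1 / 4\<close> give
  \<open>8 d \<le> M + 8\<close>, and integrality settles \<open>M = 1\<close>.\<close>

lemma block_length_le:
  assumes "1 \<le> M"
  shows "block_length M \<le> M"
proof -
  have "2 * (real (block_length M) - 1) \<le> k * (real (block_length M) - 1)"
    using k block_length_bounds(3)[of M] by (intro mult_right_mono) auto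
  also have "\<dots> \<le> \<eta> * M" by (rule block_length_bounds)
  also have "\<dots> \<le> 1 / 4 * M" using eta by (intro mult_right_mono) auto
  finally have "8 * real (block_length M) \<le> real M + 8" by (simp add: field_simps)
  then show ?thesis using assms by linarith
qed

text \<open>The hypothesis is how far off an old answer can be. The lowered target removes one
  \<open>\<eta> * M\<close>; the remaining \<open>3 * \<eta> * M\<close> fit into
  \<open>3 * k\<close> blocks and the final \<open>1\<close> into one more.\<close>

lemma blocks_needed_le:
  assumes "\<psi> * M - Q \<le> 4 * \<eta> * M + 1"
  shows "blocks_needed \<psi> M Q \<le> 3 * k + 1"
proof -
  let ?d = "real (block_length M)"
  have d: "1 \<le> ?d" using block_length_bounds(3)[of M] by simp
  have "\<psi> * M - \<eta> * M - Q \<le> 3 * (\<eta> * M) + 1" using assms by simp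
  also have "\<dots> \<le> 3 * (k * ?d) + ?d" using block_length_bounds(2)[of M] d by simp
  also have "\<dots> = (3 * k + 1) * ?d" by (simp add: algebra_simps)
  finally have "(\<psi> * M - \<eta> * M - Q) / ?d \<le> 3 * k + 1"
    using d by (simp add: pos_divide_le_eq)
  then show ?thesis
    unfolding blocks_needed_def by (simp add: ceiling_le_iff nat_le_iff)
qed

lemma blocks_needed_bounds:
  shows "\<psi> * M - \<eta> * M - Q \<le> blocks_needed \<psi> M Q * real (block_length M)"
    and "0 < blocks_needed \<psi> M Q \<Longrightarrow>
      (real (blocks_needed \<psi> M Q) - 1) * real (block_length M) < \<psi> * M - \<eta> * M - Q"
proof -
  have d: "0 < real (block_length M)" using block_length_bounds(3)[of M] by simp
  have "(\<psi> * M - \<eta> * M - Q) / real (block_length M) \<le> blocks_needed \<psi> M Q"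
    unfolding blocks_needed_def by linarith
  then show "\<psi> * M - \<eta> * M - Q \<le> blocks_needed \<psi> M Q * real (block_length M)"
    using d by (simp add: pos_divide_le_eq)
  assume "0 < blocks_needed \<psi> M Q"
  then have "real (blocks_needed \<psi> M Q) - 1 < (\<psi> * M - \<eta> * M - Q) / real (block_length M)"
    unfolding blocks_needed_def by linarith
  then show "(real (blocks_needed \<psi> M Q) - 1) * real (block_length M) < \<psi> * M - \<eta> * M - Q"
    using d by (simp add: pos_less_divide_eq)
qed

text \<open>Rounding up the number of blocks keeps \<open>(K - 1) * d\<close> below the lowered
  target, and the partial blocks add at most \<open>k * (d - 1) \<le> \<eta> * M\<close>, exactly
  the slack left. So strictly fewer than \<open>\<psi> * M\<close> keys are below \<open>y\<close>;
  at \<open>y = u\<close> all \<open>M\<close> keys would be, hence \<open>y < u\<close> and the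
  lower bound of \<open>merge_bounds\<close> applies.\<close>

lemma merge_accuracy:
  fixes B :: "nat \<Rightarrow> nat list" and x :: nat and \<psi> :: real
  defines "cnt P \<equiv> \<Sum>j\<in>{1..k}. length (filter P (B j))"
  defines "M \<equiv> cnt (\<lambda>_. True)"
  defines "K \<equiv> blocks_needed \<psi> M (cnt (\<lambda>a. a \<le> x))"
  defines "lg \<equiv> merge_log k u B x (block_length M) (K + k - 1)"
  defines "y \<equiv> current x lg (next_site k x lg)"
  assumes "x < u" "\<psi> \<le> 1" "0 < K" "\<And>j. j \<in> {1..k} \<Longrightarrow> \<forall>a\<in>set (B j). a < u"
  shows "y < u" "cnt (\<lambda>a. a < y) \<le> \<psi> * M" "cnt (\<lambda>a. a \<le> y) \<ge> \<psi> * M - \<eta> * M"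
proof -
  let ?d = "block_length M"
  have xy: "x < y" "y \<le> u"
    and b1: "cnt (\<lambda>a. x < a \<and> a < y) + k \<le> (K + k - 1) * ?d"
    and b2: "y < u \<Longrightarrow> K * ?d \<le> cnt (\<lambda>a. x < a \<and> a \<le> y)"
    using merge_bounds[of x u ?d k K B] assms(6,8) block_length_bounds(3)[of M]
    unfolding cnt_def y_def lg_def by auto
  have split: "length (filter (\<lambda>a. a < y) l) =
      length (filter (\<lambda>a. a \<le> x) l) + length (filter (\<lambda>a. x < a \<and> a < y) l)"
    "length (filter (\<lambda>a. a \<le> y) l) =
      length (filter (\<lambda>a. a \<le> x) l) + length (filter (\<lambda>a. x < a \<and> a \<le> y) l)" for l
    using xy by (induction l) auto
  have less: "cnt (\<lambda>a. a < y) = cnt (\<lambda>a. a \<le> x) + cnt (\<lambda>a. x < a \<and> a < y)"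
    and le: "cnt (\<lambda>a. a \<le> y) = cnt (\<lambda>a. a \<le> x) + cnt (\<lambda>a. x < a \<and> a \<le> y)"
    unfolding cnt_def split by (simp_all add: sum.distrib)
  have "real (cnt (\<lambda>a. x < a \<and> a < y)) + k \<le> (real K + k - 1) * ?d"
    using b1 assms(8) of_nat_mono[OF b1, where 'a = real] by (simp add: of_nat_diff)
  also have "\<dots> = (real K - 1) * ?d + k * (real ?d - 1) + k" by (simp add: algebra_simps)
  finally have "real (cnt (\<lambda>a. x < a \<and> a < y)) < \<psi> * M - cnt (\<lambda>a. a \<le> x)"
    using block_length_bounds(1)[of M]
      blocks_needed_bounds(2)[of \<psi> M "cnt (\<lambda>a. a \<le> x)", folded K_def, OF assms(8)]
    by linarith
  then have *: "cnt (\<lambda>a. a < y) < \<psi> * M" unfolding less by simp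
  then show "cnt (\<lambda>a. a < y) \<le> \<psi> * M" by simp
  show "y < u"
  proof (rule ccontr)
    assume "\<not> y < u"
    then have "y = u" using xy by simp
    have "cnt (\<lambda>a. a < y) = M"
      unfolding cnt_def M_def
    proof (rule sum.cong)
      fix j assume "j \<in> {1..k}"
      with assms(9)[of j] \<open>y = u\<close> have "filter (\<lambda>a. a < y) (B j) = filter (\<lambda>_. True) (B j)"
        by (intro filter_cong) auto
      then show "length (filter (\<lambda>a. a < y) (B j)) = length (filter (\<lambda>_. True) (B j))" by simp
    qed simp
    moreover have "\<psi> * M \<le> M" using assms(7) mult_right_mono[of \<psi> 1 "real M"] by simp
    ultimately show False using * by linarith
  qed
  from b2[OF this] have "real K * ?d \<le> cnt (\<lambda>a. x < a \<and> a \<le> y)"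
    by (metis of_nat_le_iff of_nat_mult)
  then show "cnt (\<lambda>a. a \<le> y) \<ge> \<psi> * M - \<eta> * M"
    unfolding le using blocks_needed_bounds(1)[of \<psi> M "cnt (\<lambda>a. a \<le> x)", folded K_def]
    by simp
qed

lemma tally_cong:
  assumes "\<And>j a. j \<in> {1..k} \<Longrightarrow> a \<in> set (fst (ss j)) \<Longrightarrow> P a = P' a"
  shows "tally ss P = tally ss P'"
  unfolding tally_def using assms by (intro sum.cong refl arg_cong[of _ _ length] filter_cong) auto

lemma tally_map:
  "(\<Sum>j\<in>{1..k}. length (filter P (map f (fst (ss j))))) = tally ss (\<lambda>a. P (f a))"
  by (simp add: tally_def filter_map o_def)

lemma tally_compl: "tally ss P + tally ss (\<lambda>a. \<not> P a) = tally ss (\<lambda>_. True)"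
  unfolding tally_def sum.distrib[symmetric]
  by (intro sum.cong) (auto simp: sum_length_filter_compl)

lemma merged_answer_accuracy:
  fixes ss :: "nat \<Rightarrow> site_state" and x dir :: nat and \<psi> :: real
  defines "B \<equiv> \<lambda>j. map (key u dir) (fst (ss j))"
  defines "M \<equiv> tally ss (\<lambda>_. True)"
  defines "K \<equiv> blocks_needed \<psi> M (tally ss (\<lambda>a. key u dir a \<le> key u dir x))"
  defines "lg \<equiv> merge_log k u B (key u dir x) (block_length M) (K + k - 1)"
  defines "y \<equiv> current (key u dir x) lg (next_site k (key u dir x) lg)"
  assumes "x \<in> {1..u}" "\<psi> \<le> 1" "0 < K" "\<And>j. j \<in> {1..k} \<Longrightarrow> set (fst (ss j)) \<subseteq> {1..u}"
  shows "y < u" "tally ss (\<lambda>a. key u dir a < y) \<le> \<psi> * M"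
    "tally ss (\<lambda>a. key u dir a \<le> y) \<ge> \<psi> * M - \<eta> * M"
proof -
  have "key u dir x < u" using assms(6) by (auto simp: key_def)
  moreover have "\<forall>a\<in>set (B j). a < u" if "j \<in> {1..k}" for j
    using assms(9)[OF that] by (force simp: B_def key_def)
  ultimately show "y < u" "tally ss (\<lambda>a. key u dir a < y) \<le> \<psi> * M"
      "tally ss (\<lambda>a. key u dir a \<le> y) \<ge> \<psi> * M - \<eta> * M"
    using merge_accuracy[of "key u dir x" \<psi> B] assms(7,8)
    unfolding B_def tally_map M_def[symmetric] K_def[symmetric] lg_def[symmetric, unfolded B_def]
      y_def[symmetric]
    by auto
qed

text \<open>A poll followed by a merge restores the error to \<open>\<eta> * M\<close> on either
  side. The poll costs \<open>4 * k\<close> words and the at most \<open>4 * k\<close> block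
  requests \<open>5\<close> words each, which gives \<open>24 * k\<close>.\<close>

lemma recompute:
  fixes ss :: "nat \<Rightarrow> site_state" and x :: nat
  defines "M \<equiv> tally ss (\<lambda>_. True)"
  assumes items: "\<And>j. j \<in> {1..k} \<Longrightarrow> set (fst (ss j)) \<subseteq> {1..u}"
    and x: "x \<in> {1..u}" and M: "1 \<le> M"
    and low: "\<phi> * M - tally ss (\<lambda>a. a \<le> x) \<le> 4 * \<eta> * M + 1"
    and high: "tally ss (\<lambda>a. a < x) - \<phi> * M \<le> 4 * \<eta> * M + 1"
    and w: "u \<le> w" "M \<le> w" "4 * k \<le> w"
  shows "\<exists>x' tr. exchange tracker (ss, (x, m0, R, Poll 1 0 0 0)) [Down 1 [x]] tr (ss, (x', M, R, Idle)) \<and>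
    x' \<in> {1..u} \<and> tally ss (\<lambda>a. a < x') \<le> \<phi> * M + \<eta> * M \<and>
    tally ss (\<lambda>a. a \<le> x') \<ge> \<phi> * M - \<eta> * M \<and> word_cost tr \<le> 24 * k \<and> bounded_words w tr"
proof -
  define L where "L = tally ss (\<lambda>a. a < x)"
  define Q where "Q = tally ss (\<lambda>a. a \<le> x)"
  define K0 where "K0 = blocks_needed \<phi> M Q"
  define K1 where "K1 = blocks_needed (1 - \<phi>) M (M - L)"
  define dir :: nat where "dir = (if 0 < K0 then 0 else 1)"
  define K where "K = (if 0 < K0 then K0 else K1)"
  define S where "S = (if K = 0 then 0 else K + k - 1)"
  define kx where "kx = key u dir x"
  define d where "d = block_length M"
  define B where "B = (\<lambda>j. map (key u dir) (fst (ss j)))"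
  define lg where "lg = merge_log k u B kx d S"
  define y where "y = current kx lg (next_site k kx lg)"
  define x' where "x' = unkey u dir y"
  have LM: "L + tally ss (\<lambda>a. x \<le> a) = M"
    using tally_compl[of ss "\<lambda>a. a < x"] by (simp add: L_def M_def not_less)
  have "K0 \<le> 3 * k + 1"
    unfolding K0_def using low by (intro blocks_needed_le) (simp add: Q_def)
  moreover have "K1 \<le> 3 * k + 1"
    \<comment> \<open>The mirrored deficit \<open>(1 - \<phi>) * M - (M - L)\<close> equals
      \<open>L - \<phi> * M\<close>.\<close>
    unfolding K1_def using high LM
    by (intro blocks_needed_le) (simp add: L_def[symmetric] algebra_simps of_nat_diff)
  \<comment> \<open>\<open>K \<le> 3 * k + 1\<close> and the \<open>k - 1\<close> additional
    requests make \<open>4 * k\<close>.\<close>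
  ultimately have S: "S \<le> 4 * k" unfolding S_def K_def by (auto split: if_splits)
  obtain c' out where step: "merge_step x M R dir d S [] = (c', out)" by fastforce
  then have start: "start_merge x M R L Q = (c', out)"
    unfolding start_merge_def Let_def K0_def K1_def dir_def K_def S_def d_def .
  have "kx \<le> u" "dir \<le> 1" using x by (auto simp: kx_def key_def dir_def)
  then have "\<exists>tr. exchange tracker (ss, c') (map (\<lambda>(i, m'). Down i m') out) tr (ss, (x', M, R, Idle))
      \<and> word_cost tr = 5 * (S - 0) \<and> bounded_words w tr"
    unfolding x'_def y_def lg_def B_def kx_def
    using w S x block_length_le[OF M] step
    by (intro merge_exchange) (auto simp: d_def)
  then obtain tr1 where tr1:
    "exchange tracker (ss, c') (map (\<lambda>(i, m'). Down i m') out) tr1 (ss, (x', M, R, Idle))"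
    "word_cost tr1 = 5 * S" "bounded_words w tr1" by auto
  have "\<exists>tr'. exchange tracker (ss, (x, m0, R, Poll 1 0 0 0)) [Down 1 [x]] tr' (ss, (x', M, R, Idle)) \<and>
      word_cost tr' = 4 * (k + 1 - 1) + word_cost tr1 \<and> bounded_words w tr'"
    using poll_exchange[where ss = ss and x = x and R = R and c' = c' and out = out and tr = tr1
        and cfg' = "(ss, (x', M, R, Idle))" and w = w and i = 1 and ?m0.0 = m0]
      start tr1 w x by (simp add: M_def L_def Q_def)
  then obtain tr where tr:
    "exchange tracker (ss, (x, m0, R, Poll 1 0 0 0)) [Down 1 [x]] tr (ss, (x', M, R, Idle))"
    "word_cost tr \<le> 24 * k" "bounded_words w tr"
    using S tr1(2) by auto
  have eM: "0 \<le> \<eta> * M" using eta by simp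
  have "x' \<in> {1..u} \<and> tally ss (\<lambda>a. a < x') \<le> \<phi> * M + \<eta> * M \<and> tally ss (\<lambda>a. a \<le> x') \<ge> \<phi> * M - \<eta> * M"
  \<comment> \<open>Without requests the log is empty and the merge returns its starting key, so the
    answer stays. That \<open>K0\<close> and \<open>K1\<close> vanish says that it is already
    accurate enough.\<close>
  proof (cases "K = 0")
    case True
    then have "K0 = 0" "K1 = 0" by (auto simp: K_def split: if_splits)
    have "dir = 1" "y = kx" using True \<open>K0 = 0\<close> by (auto simp: dir_def y_def lg_def S_def)
    then have "x' = x" using x by (auto simp: x'_def kx_def unkey_def key_def)
    have "\<phi> * M - \<eta> * M \<le> Q" using blocks_needed_bounds(1)[of \<phi> M Q] \<open>K0 = 0\<close> by (simp add: K0_def)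
    moreover have "(1 - \<phi>) * M - \<eta> * M \<le> real (M - L)"
      using blocks_needed_bounds(1)[of "1 - \<phi>" M "M - L"] \<open>K1 = 0\<close> by (simp add: K1_def)
    then have "L \<le> \<phi> * M + \<eta> * M" using LM by (simp add: of_nat_diff algebra_simps)
    ultimately show ?thesis using x \<open>x' = x\<close> by (simp add: L_def Q_def)
  next
    case K: False
    show ?thesis
    proof (cases "0 < K0")
      case True
      then have dir: "dir = 0" and KK: "K = K0" by (simp_all add: dir_def K_def)
      have pos: "1 \<le> a" if "i \<in> {1..k}" "a \<in> set (fst (ss i))" for i a
        using items[OF that(1)] that(2) by auto
      have le: "key u 0 a \<le> v \<longleftrightarrow> a \<le> v + 1" and less: "key u 0 a < v \<longleftrightarrow> a < v + 1"
        if "1 \<le> a" for a v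
        using that by (auto simp: key_def)
      have tle: "tally ss (\<lambda>a. key u 0 a \<le> v) = tally ss (\<lambda>a. a \<le> v + 1)"
        and tless: "tally ss (\<lambda>a. key u 0 a < v) = tally ss (\<lambda>a. a < v + 1)" for v
        by (intro tally_cong le less pos; assumption)+
      have "K = blocks_needed \<phi> M (tally ss (\<lambda>a. key u dir a \<le> key u dir x))"
        using x unfolding dir tle KK K0_def Q_def by (simp add: key_def)
      then have "y < u" "tally ss (\<lambda>a. key u dir a < y) \<le> \<phi> * M"
        "tally ss (\<lambda>a. key u dir a \<le> y) \<ge> \<phi> * M - \<eta> * M"
        using merged_answer_accuracy[of x \<phi> ss dir] x phi K items
        by (simp_all add: y_def lg_def S_def kx_def d_def B_def M_def)
      then show ?thesis
        using eM unfolding dir tle tless x'_def unkey_def by simp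
    next
      case False
      then have dir: "dir = 1" and KK: "K = K1" by (simp_all add: dir_def K_def)
      have tle: "tally ss (\<lambda>a. key u 1 a \<le> v) = tally ss (\<lambda>a. u - v \<le> a)" for v
        by (auto intro!: tally_cong simp: key_def)
      have tless: "tally ss (\<lambda>a. key u 1 a < v) = tally ss (\<lambda>a. u - v < a)" if "v < u" for v
      proof (rule tally_cong)
        fix j a assume "j \<in> {1..k}" "a \<in> set (fst (ss j))"
        then have "a \<le> u" "1 \<le> a" using items by force+
        then show "key u 1 a < v \<longleftrightarrow> u - v < a" using that by (auto simp: key_def)
      qed
      have "K = blocks_needed (1 - \<phi>) M (tally ss (\<lambda>a. key u dir a \<le> key u dir x))"
      proof -
        have "M - L = tally ss (\<lambda>a. x \<le> a)" using LM by simp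
        then show ?thesis using x unfolding dir tle KK K1_def by (simp add: key_def)
      qed
      then have y: "y < u" "tally ss (\<lambda>a. key u dir a < y) \<le> (1 - \<phi>) * M"
        "tally ss (\<lambda>a. key u dir a \<le> y) \<ge> (1 - \<phi>) * M - \<eta> * M"
        using merged_answer_accuracy[of x "1 - \<phi>" ss dir] x phi K items
        by (simp_all add: y_def lg_def S_def kx_def d_def B_def M_def)
      have x': "x' = u - y" by (simp add: x'_def unkey_def dir)
      \<comment> \<open>Complements undo the reflection: few items above \<open>x'\<close> means
        many not above it, and many items not below \<open>x'\<close> means few below.\<close>
      have "tally ss (\<lambda>a. a < x') + tally ss (\<lambda>a. x' \<le> a) = M"
        "tally ss (\<lambda>a. a \<le> x') + tally ss (\<lambda>a. x' < a) = M"
        using tally_compl[of ss "\<lambda>a. a < x'"] tally_compl[of ss "\<lambda>a. a \<le> x'"]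
        by (simp_all add: M_def not_less not_le)
      then have "real (tally ss (\<lambda>a. a < x')) + tally ss (\<lambda>a. x' \<le> a) = M"
        "real (tally ss (\<lambda>a. a \<le> x')) + tally ss (\<lambda>a. x' < a) = M"
        by (metis of_nat_add)+
      moreover have "tally ss (\<lambda>a. x' < a) \<le> (1 - \<phi>) * M" "tally ss (\<lambda>a. x' \<le> a) \<ge> (1 - \<phi>) * M - \<eta> * M"
        using y unfolding dir tle tless[OF y(1)] x' by auto
      ultimately show ?thesis
        using eM y(1) x' by (auto simp: algebra_simps)
    qed
  qed
  with tr show ?thesis by blast
qed

section \<open>Potential and invariant of the amortized analysis\<close>

text \<open>An upper bound for the number of growth steps by a factor \<open>1 + \<eta>\<close> up to \<open>m\<close>.\<close>

definition pot :: "nat \<Rightarrow> real" where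
  "pot m = (if m = 0 then 0 else 1 + log (1 + \<eta>) m)"

lemma pot_nonneg: "0 \<le> pot m"
  using eta by (simp add: pot_def zero_le_log_cancel_iff)

lemma pot_mono: "m \<le> n \<Longrightarrow> pot m \<le> pot n"
  using pot_nonneg[of n] eta by (auto simp: pot_def log_le_cancel_iff)

text \<open>The logarithm to base \<open>1 + \<eta>\<close> gains one per growth step; the summand
  \<open>1\<close> in \<open>pot\<close> pays for the step from \<open>0\<close> to a positive
  number.\<close>

lemma pot_step:
  assumes "real n > (1 + \<eta>) * m"
  shows "pot m + 1 \<le> pot n"
proof (cases "m = 0")
  case True
  then show ?thesis using assms eta by (auto simp: pot_def zero_le_log_cancel_iff)
next
  case False
  then have pos: "0 < (1 + \<eta>) * m" using eta by simp
  then have "log (1 + \<eta>) ((1 + \<eta>) * m) \<le> log (1 + \<eta>) n"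
    using assms eta by (subst log_le_cancel_iff) auto
  moreover have "log (1 + \<eta>) ((1 + \<eta>) * m) = 1 + log (1 + \<eta>) m"
    using False eta by (subst log_mult) auto
  moreover have "n \<noteq> 0" using assms pos by (intro notI) simp
  ultimately show ?thesis using False by (simp add: pot_def)
qed

text \<open>The rank bounds allow for the items since the last recomputation: all of them may lie
  below \<open>x\<close>, or all above. In the cost bound, a recomputation is charged to the growth
  of \<open>m0\<close> and a one-word report to the growth of the site's reported count.\<close>

definition invariant ::
  "stream \<Rightarrow> packet list \<Rightarrow> (nat \<Rightarrow> site_state) \<Rightarrow> nat \<Rightarrow> nat \<Rightarrow> nat \<Rightarrow> bool" where
  "invariant xs tr ss x m0 R \<longleftrightarrow>
     x \<in> {1..u} \<and> m0 \<le> length xs \<and>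
     R = (\<Sum>j\<in>{1..k}. snd (ss j)) \<and> R \<le> (1 + \<eta>) * m0 \<and>
     (\<forall>j\<in>{1..k}. set (fst (ss j)) \<subseteq> {1..u} \<and> length (fst (ss j)) \<le> (1 + \<eta>) * real (snd (ss j))
        \<and> snd (ss j) \<le> length (fst (ss j))) \<and>
     (\<forall>P. tally ss P = length (filter P (map snd xs))) \<and>
     tally ss (\<lambda>a. a < x) \<le> (\<phi> + \<eta>) * m0 + (real (length xs) - m0) \<and>
     tally ss (\<lambda>a. a \<le> x) \<ge> (\<phi> - \<eta>) * m0 \<and>
     word_cost tr \<le> 24 * k * pot m0 + (\<Sum>j\<in>{1..k}. pot (snd (ss j))) \<and>
     bounded_words (max (max u (length xs)) (4 * k)) tr"

text \<open>Two delays multiply: unreported items at the sites, and reported items that have not yet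
  triggered a recomputation. \<open>(1 + \<eta>)\<^sup>2 - 1\<close> is at most
  \<open>3 * \<eta>\<close> since \<open>\<eta> \<le> 1\<close>.\<close>

lemma total_growth:
  assumes "R = (\<Sum>j\<in>{1..k}. snd (ss j))" "real R \<le> (1 + \<eta>) * m0"
    and "\<And>j. j \<in> {1..k} \<Longrightarrow> length (fst (ss j)) \<le> (1 + \<eta>) * real (snd (ss j))"
  shows "tally ss (\<lambda>_. True) - real m0 \<le> 3 * \<eta> * m0"
proof -
  have "real (tally ss (\<lambda>_. True)) = (\<Sum>j\<in>{1..k}. real (length (fst (ss j))))"
    by (simp add: tally_def)
  also have "\<dots> \<le> (\<Sum>j\<in>{1..k}. (1 + \<eta>) * real (snd (ss j)))"
    using assms(3) by (intro sum_mono) auto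
  also have "\<dots> = (1 + \<eta>) * R" by (simp add: assms(1) sum_distrib_left)
  also have "\<dots> \<le> (1 + \<eta>) * ((1 + \<eta>) * m0)" using assms(2) eta by (intro mult_left_mono) auto
  finally have "tally ss (\<lambda>_. True) \<le> (1 + \<eta>) * ((1 + \<eta>) * m0)" .
  moreover have "\<eta> * (\<eta> * m0) \<le> 1 * (\<eta> * m0)" using eta by (intro mult_right_mono) auto
  ultimately show ?thesis by (simp add: algebra_simps)
qed

text \<open>Free of subtraction, so that one lemma serves natural counts and real
  potentials.\<close>

lemma sum_update:
  fixes g :: "site_state \<Rightarrow> 'a::comm_monoid_add"
  assumes "j \<in> {1..k}"
  shows "(\<Sum>i\<in>{1..k}. g ((ss(j := s)) i)) + g (ss j) = (\<Sum>i\<in>{1..k}. g (ss i)) + g s"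
proof -
  have "(\<Sum>i\<in>{1..k}. g ((ss(j := s)) i)) = g s + (\<Sum>i\<in>{1..k} - {j}. g (ss i))"
    by (subst sum.remove[OF _ assms]) (auto intro!: sum.cong arg_cong2[of _ _ _ _ "(+)"])
  moreover have "(\<Sum>i\<in>{1..k}. g (ss i)) = g (ss j) + (\<Sum>i\<in>{1..k} - {j}. g (ss i))"
    by (rule sum.remove) (use assms in auto)
  ultimately show ?thesis by (simp add: ac_simps)
qed

lemma tally_arrival:
  assumes "j \<in> {1..k}"
  shows "tally (ss(j := (a # fst (ss j), r))) P = tally ss P + (if P a then 1 else 0)"
  using sum_update[OF assms, of "\<lambda>s. length (filter P (fst s))" ss "(a # fst (ss j), r)"]
  unfolding tally_def by (cases "P a") (simp_all del: fun_upd_apply)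

lemma invariant_step:
  assumes inv: "invariant xs tr ss x m0 R" and j: "j \<in> {1..k}" and a: "a \<in> {1..u}"
  shows "\<exists>s' out tr' ss' x' m0' R'. item_arrives (ss j) a = (s', out) \<and>
    exchange tracker (ss(j := s'), (x, m0, R, Idle)) (map (Up j) out) tr' (ss', (x', m0', R', Idle)) \<and>
    invariant (xs @ [(j, a)]) (tr @ tr') ss' x' m0' R'"
proof -
  define as where "as = a # fst (ss j)"
  define r where "r = snd (ss j)"
  define rep where "rep \<longleftrightarrow> real (length as) > (1 + \<eta>) * r"
  define r' where "r' = (if rep then length as else r)"
  define ss' where "ss' = ss(j := (as, r'))"
  define R1 where "R1 = R + (r' - r)"
  define w where "w = max (max u (length (xs @ [(j, a)]))) (4 * k)"
  have x: "x \<in> {1..u}" and m0: "m0 \<le> length xs"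
    and R: "R = (\<Sum>i\<in>{1..k}. snd (ss i))" "real R \<le> (1 + \<eta>) * m0"
    and sites: "\<And>i. i \<in> {1..k} \<Longrightarrow> set (fst (ss i)) \<subseteq> {1..u}"
      "\<And>i. i \<in> {1..k} \<Longrightarrow> length (fst (ss i)) \<le> (1 + \<eta>) * real (snd (ss i))"
      "\<And>i. i \<in> {1..k} \<Longrightarrow> snd (ss i) \<le> length (fst (ss i))"
    and tal: "\<And>P. tally ss P = length (filter P (map snd xs))"
    and less: "tally ss (\<lambda>a. a < x) \<le> (\<phi> + \<eta>) * m0 + (real (length xs) - m0)"
    and le: "tally ss (\<lambda>a. a \<le> x) \<ge> (\<phi> - \<eta>) * m0"
    and cost: "word_cost tr \<le> 24 * k * pot m0 + (\<Sum>i\<in>{1..k}. pot (snd (ss i)))"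
    and bnd: "bounded_words (max (max u (length xs)) (4 * k)) tr"
    using inv unfolding invariant_def by auto
  have bnd': "bounded_words w tr"
    using bnd by (rule bounded_words_mono) (auto simp: w_def le_max_iff_disj)
  have rr': "r \<le> r'"
    using sites(3)[OF j] by (simp add: r'_def r_def as_def)
  have tally': "tally ss' P = tally ss P + (if P a then 1 else 0)" for P
    unfolding ss'_def as_def by (rule tally_arrival[OF j])
  have tal': "tally ss' P = length (filter P (map snd (xs @ [(j, a)])))" for P
    by (simp add: tally' tal)
  have M: "tally ss' (\<lambda>_. True) = length xs + 1" by (simp add: tal')
  have sites': "set (fst (ss' i)) \<subseteq> {1..u}" "length (fst (ss' i)) \<le> (1 + \<eta>) * real (snd (ss' i))"
    "snd (ss' i) \<le> length (fst (ss' i))" if "i \<in> {1..k}" for i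
    using sites[OF that] a eta
    by (auto simp: ss'_def r'_def as_def rep_def r_def algebra_simps)
  have R1: "R1 = (\<Sum>i\<in>{1..k}. snd (ss' i))"
    using sum_update[OF j, of snd ss "(as, r')"] rr'
    unfolding R1_def R(1) ss'_def r_def by simp
  \<comment> \<open>A report raises the potential of its site by at least one, which pays for its
    single word.\<close>
  have pots: "(\<Sum>i\<in>{1..k}. pot (snd (ss i))) + (if rep then 1 else 0) \<le> (\<Sum>i\<in>{1..k}. pot (snd (ss' i)))"
    using sum_update[OF j, of "\<lambda>s. pot (snd s)" ss "(as, r')"] pot_step[of r "length as"]
    by (simp add: ss'_def r'_def r_def[symmetric] rep_def del: fun_upd_apply split: if_splits)
  \<comment> \<open>This covers both cases in which the answer is kept: no report, or a report that
    triggers no recomputation.\<close>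
  have keep: "invariant (xs @ [(j, a)]) (tr @ t) ss' x m0 R1"
    if "real R1 \<le> (1 + \<eta>) * m0" "word_cost t = (if rep then 1 else 0)" "bounded_words w t" for t
    unfolding invariant_def
  proof (intro conjI ballI allI)
    show "tally ss' (\<lambda>a. a < x) \<le> (\<phi> + \<eta>) * m0 + (real (length (xs @ [(j, a)])) - m0)"
      using less by (simp add: tally')
    show "(\<phi> - \<eta>) * m0 \<le> tally ss' (\<lambda>a. a \<le> x)"
      using le by (simp add: tally')
    show "word_cost (tr @ t) \<le> 24 * k * pot m0 + (\<Sum>i\<in>{1..k}. pot (snd (ss' i)))"
      using cost pots that(2) by (simp split: if_splits)
    show "bounded_words (max (max u (length (xs @ [(j, a)]))) (4 * k)) (tr @ t)"
      using bnd' that(3) by (simp add: w_def)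
  qed (use x m0 R1 that sites' tal' in auto)
  show ?thesis
  proof (cases rep)
    case False
    then have "item_arrives (ss j) a = ((as, r'), [])"
      by (simp add: item_arrives_def Let_def as_def r'_def r_def rep_def)
    moreover have "exchange tracker (ss', (x, m0, R, Idle)) (map (Up j) []) [] (ss', (x, m0, R, Idle))"
      by (simp add: exchange.quiet)
    moreover have "R1 = R" using False by (simp add: R1_def r'_def)
    then have "invariant (xs @ [(j, a)]) (tr @ []) ss' x m0 R"
      using keep[of "[]"] R(2) False by simp
    ultimately show ?thesis unfolding ss'_def by blast
  next
    case True
    define msg where "msg = [length as - r]"
    have item: "item_arrives (ss j) a = ((as, r'), [msg])"
      using True by (simp add: item_arrives_def Let_def as_def r'_def r_def rep_def msg_def)
    have R1': "R + hd msg = R1" using True by (simp add: R1_def r'_def msg_def)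
    have "length as \<le> length xs + 1"
    proof -
      have "length (filter (\<lambda>_. True) (fst (ss' j))) \<le> tally ss' (\<lambda>_. True)"
        unfolding tally_def using j by (intro member_le_sum) auto
      then show ?thesis using M by (simp add: ss'_def)
    qed
    then have msg_bnd: "bounded_words w [Up j msg]"
      by (simp add: msg_def w_def)
    show ?thesis
    proof (cases "real R1 \<le> (1 + \<eta>) * m0")
      case small: True
      have "exchange tracker (ss', (x, m0, R, Idle)) (map (Up j) [msg]) [Up j msg] (ss', (x, m0, R1, Idle))"
        using small
        by (auto simp: R1' Let_def intro!: exchange_up[where out = "[]"] exchange.quiet)
      moreover have "invariant (xs @ [(j, a)]) (tr @ [Up j msg]) ss' x m0 R1"
        using keep[of "[Up j msg]"] small True msg_bnd by (simp add: msg_def)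
      ultimately show ?thesis using item unfolding ss'_def by blast
    next
      case large: False
      define M where "M = length xs + 1"
      have growth: "real (length xs) - m0 \<le> 3 * \<eta> * m0"
        using total_growth[OF R sites(2)] tal[of "\<lambda>_. True"] by simp
      have em: "0 \<le> \<eta> * m0" "\<eta> * m0 \<le> \<eta> * M"
        using eta m0 by (auto simp: M_def intro!: mult_left_mono)
      have pm: "0 \<le> \<phi> * (real M - m0)" "\<phi> * (real M - m0) \<le> real M - m0"
        using phi m0 by (auto simp: M_def mult_left_le_one_le)
      \<comment> \<open>The old answer was off by at most \<open>\<eta> * m0\<close>, and at most
        \<open>3 * \<eta> * m0\<close> items had come since then; the \<open>1\<close> is the item
        now arriving.\<close>
      have low: "\<phi> * M - tally ss' (\<lambda>a. a \<le> x) \<le> 4 * \<eta> * M + 1"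
        using le growth em pm by (simp add: tally' M_def algebra_simps)
      have high: "tally ss' (\<lambda>a. a < x) - \<phi> * M \<le> 4 * \<eta> * M + 1"
        using less growth em pm by (simp add: tally' M_def algebra_simps)
      have tM: "tally ss' (\<lambda>_. True) = M" using M by (simp add: M_def)
      have wM: "1 \<le> M" "u \<le> w" "M \<le> w" "4 * k \<le> w"
        by (auto simp: M_def w_def le_max_iff_disj)
      obtain x' t where t:
        "exchange tracker (ss', (x, m0, R1, Poll 1 0 0 0)) [Down 1 [x]] t (ss', (x', M, R1, Idle))"
        "x' \<in> {1..u}" "tally ss' (\<lambda>a. a < x') \<le> \<phi> * M + \<eta> * M"
        "tally ss' (\<lambda>a. a \<le> x') \<ge> \<phi> * M - \<eta> * M" "word_cost t \<le> 24 * k" "bounded_words w t"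
        using recompute[of ss' x w m0 R1] sites'(1) x low high wM unfolding tM by auto
      have ex: "exchange tracker (ss', (x, m0, R, Idle)) (map (Up j) [msg]) (Up j msg # t)
          (ss', (x', M, R1, Idle))"
        unfolding list.map
        by (rule exchange_up[where out = "[(1, [x])]"])
          (use t(1) large in \<open>simp_all add: R1' Let_def\<close>)
      \<comment> \<open>The trigger looks at reported items only, but these are at most
        \<open>M\<close>. So \<open>M\<close> exceeds \<open>(1 + \<eta>) * m0\<close>, and the gain
        in \<open>pot\<close> pays the \<open>24 * k\<close> words.\<close>
      have RM: "R1 \<le> M"
      proof -
        have "R1 \<le> (\<Sum>i\<in>{1..k}. length (fst (ss' i)))"
          unfolding R1 using sites'(3) by (intro sum_mono) auto
        also have "\<dots> = M" using M by (simp add: tally_def M_def)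
        finally show ?thesis .
      qed
      have "pot m0 + 1 \<le> pot M"
        using large RM by (intro pot_step) simp
      then have "24 * k * (pot m0 + 1) \<le> 24 * k * pot M"
        by (intro mult_left_mono) auto
      then have pM: "24 * k * pot m0 + 24 * k \<le> 24 * k * pot M"
        by (simp add: algebra_simps)
      have cost_t: "real (word_cost (tr @ Up j msg # t)) \<le> real (word_cost tr) + 1 + 24 * k"
        using t(5) by (simp add: msg_def)
      have "invariant (xs @ [(j, a)]) (tr @ Up j msg # t) ss' x' M R1"
        unfolding invariant_def
      proof (intro conjI ballI allI)
        show "R1 \<le> (1 + \<eta>) * M"
        proof -
          have "real R1 \<le> M" using RM by simp
          also have "\<dots> \<le> (1 + \<eta>) * M" using eta by (simp add: algebra_simps)
          finally show ?thesis .
        qed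
        show "tally ss' (\<lambda>a. a < x') \<le> (\<phi> + \<eta>) * M + (real (length (xs @ [(j, a)])) - M)"
          using t(3) by (simp add: M_def algebra_simps)
        show "(\<phi> - \<eta>) * M \<le> tally ss' (\<lambda>a. a \<le> x')"
          using t(4) by (simp add: algebra_simps)
        show "word_cost (tr @ Up j msg # t) \<le> 24 * k * pot M + (\<Sum>i\<in>{1..k}. pot (snd (ss' i)))"
          using cost pots True pM cost_t by simp
        show "bounded_words (max (max u (length (xs @ [(j, a)]))) (4 * k)) (tr @ Up j msg # t)"
          using bnd' msg_bnd t(6) by (simp add: w_def)
      qed (use t R1 sites' tal' in \<open>auto simp: M_def\<close>)
      then show ?thesis using ex item unfolding ss'_def by blast
    qed
  qed
qed

section \<open>Accuracy and cost of whole runs\<close>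

lemma tracker_run:
  assumes "xs \<in> streams k u"
  shows "\<exists>tr ss x m0 R. run tracker xs tr (ss, (x, m0, R, Idle)) \<and> invariant xs tr ss x m0 R"
  using assms
proof (induction xs rule: rev_induct)
  case Nil
  have "invariant [] [] (\<lambda>i. ([], 0)) 1 0 0"
    using u by (simp add: invariant_def tally_def pot_def)
  moreover have "run tracker [] [] (\<lambda>i. ([], 0), (1, 0, 0, Idle))"
    using run.start[of tracker] by simp
  ultimately show ?case by blast
next
  case (snoc e xs)
  obtain j a where e: "e = (j, a)" by fastforce
  with snoc.prems have ja: "j \<in> {1..k}" "a \<in> {1..u}" and xs: "xs \<in> streams k u"
    by (auto simp: streams_def)
  from snoc.IH[OF xs] obtain tr ss x m0 R where
    "run tracker xs tr (ss, (x, m0, R, Idle))" "invariant xs tr ss x m0 R" by blast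
  with invariant_step[OF this(2) ja] show ?case
    unfolding e using run.arrival[of tracker] tracker_simps(2) by metis
qed

text \<open>The error \<open>\<eta> * m0\<close> of the last recomputation and at most
  \<open>3 * \<eta> * m0\<close> new items add up to \<open>4 * \<eta>\<close>, relative to all
  items.\<close>

lemma invariant_approx_quantile:
  assumes "invariant xs tr ss x m0 R"
  shows "is_approx_quantile u (4 * \<eta>) \<phi> (mset (map snd xs)) x"
proof -
  define m where "m = length xs"
  define L where "L = length (filter (\<lambda>a. a < x) (map snd xs))"
  define Q where "Q = length (filter (\<lambda>a. a \<le> x) (map snd xs))"
  have x: "x \<in> {1..u}" and m0: "m0 \<le> m"
    and R: "R = (\<Sum>i\<in>{1..k}. snd (ss i))" "real R \<le> (1 + \<eta>) * m0"
    and sites: "\<And>i. i \<in> {1..k} \<Longrightarrow> length (fst (ss i)) \<le> (1 + \<eta>) * real (snd (ss i))"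
    and tal: "\<And>P. tally ss P = length (filter P (map snd xs))"
    and less: "L \<le> (\<phi> + \<eta>) * m0 + (real m - m0)"
    and le: "Q \<ge> (\<phi> - \<eta>) * m0"
    using assms unfolding invariant_def m_def L_def Q_def by auto
  have growth: "real m - m0 \<le> 3 * \<eta> * m0"
    using total_growth[OF R sites] tal[of "\<lambda>_. True"] by (simp add: m_def)
  have em: "0 \<le> \<eta> * m0" "\<eta> * m0 \<le> \<eta> * m"
    using eta m0 by (auto intro!: mult_left_mono)
  have pm: "0 \<le> \<phi> * (real m - m0)" "\<phi> * (real m - m0) \<le> real m - m0"
    using phi m0 by (auto simp: mult_left_le_one_le)
  have L: "L \<le> (\<phi> + 4 * \<eta>) * m" and Q: "Q \<ge> (\<phi> - 4 * \<eta>) * m"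
    using less le growth em pm by (auto simp: algebra_simps)
  have LQ: "L \<le> Q"
    unfolding L_def Q_def by (subst (1 2) length_filter_conv_card, intro card_mono) auto
  have size: "size {#a \<in># mset (map snd xs). a < x#} = L" "size (mset (map snd xs)) = m"
    by (simp_all only: L_def m_def mset_filter[symmetric] size_mset length_map)
  have greater: "real (size {#a \<in># mset (map snd xs). x < a#}) = real m - Q"
    using sum_length_filter_compl[of "\<lambda>a. a \<le> x" "map snd xs"]
    by (simp only: Q_def m_def mset_filter[symmetric] size_mset length_map not_le)
  show ?thesis
  proof (cases "m = 0")
    case True
    then show ?thesis
      using x eta unfolding is_approx_quantile_def is_quantile_def
      by (intro exI[of _ \<phi>]) (simp add: m_def)
  next
    case False
    \<comment> \<open>The quantiles that \<open>x\<close> represents form the interval from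
      \<open>L / m\<close> to \<open>Q / m\<close>. It meets the interval of radius
      \<open>4 * \<eta>\<close> around \<open>\<phi>\<close>, and the larger of the two left ends
      lies in both.\<close>
    define \<psi> where "\<psi> = max (\<phi> - 4 * \<eta>) (L / m)"
    have "L / m \<le> \<phi> + 4 * \<eta>" using L False by (simp add: pos_divide_le_eq)
    then have "\<phi> - 4 * \<eta> \<le> \<psi>" "\<psi> \<le> \<phi> + 4 * \<eta>" using eta by (auto simp: \<psi>_def)
    moreover have "L / m \<le> \<psi>" by (simp add: \<psi>_def)
    then have "L \<le> \<psi> * m" using False by (simp add: pos_divide_le_eq)
    moreover have "\<psi> * m \<le> Q" using Q LQ False by (auto simp: \<psi>_def max_def)
    then have "real m - Q \<le> (1 - \<psi>) * m" by (simp add: algebra_simps)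
    ultimately show ?thesis
      using x unfolding is_approx_quantile_def is_quantile_def size greater by blast
  qed
qed

text \<open>\<open>m0\<close> and each of the \<open>k\<close> reported counts are at most the
  stream length, and \<open>24 * k + k = 25 * k\<close>.\<close>

lemma invariant_cost:
  assumes "invariant xs tr ss x m0 R"
  shows "word_cost tr \<le> 25 * k * pot (length xs)"
proof -
  have m0: "m0 \<le> length xs"
    and sites: "\<And>i. i \<in> {1..k} \<Longrightarrow> snd (ss i) \<le> length (fst (ss i))"
    and tal: "tally ss (\<lambda>_. True) = length (filter (\<lambda>_. True) (map snd xs))"
    and cost: "word_cost tr \<le> 24 * k * pot m0 + (\<Sum>i\<in>{1..k}. pot (snd (ss i)))"
    using assms unfolding invariant_def by auto
  have "snd (ss i) \<le> length xs" if "i \<in> {1..k}" for i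
  proof -
    have "length (filter (\<lambda>_. True) (fst (ss i))) \<le> tally ss (\<lambda>_. True)"
      unfolding tally_def using that by (intro member_le_sum) auto
    then show ?thesis using sites[OF that] tal by simp
  qed
  then have "(\<Sum>i\<in>{1..k}. pot (snd (ss i))) \<le> (\<Sum>i\<in>{1..k}. pot (length xs))"
    by (intro sum_mono pot_mono)
  also have "\<dots> = k * pot (length xs)" by simp
  finally have "(\<Sum>i\<in>{1..k}. pot (snd (ss i))) \<le> k * pot (length xs)" .
  moreover have "24 * k * pot m0 \<le> 24 * k * pot (length xs)"
    using pot_mono[OF m0] by (intro mult_left_mono) auto
  moreover have "25 * k * pot (length xs) = 24 * k * pot (length xs) + k * pot (length xs)"
    by (simp add: algebra_simps)
  ultimately show ?thesis using cost by linarith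
qed

text \<open>\<open>ln (1 + \<eta>) \<ge> \<eta> - \<eta>\<^sup>2 \<ge> \<eta> / 2\<close> for
  \<open>\<eta> \<le> 1 / 4\<close>, and \<open>ln 2 \<le> 1\<close>. For \<open>2 \<le> n\<close>
  the summand \<open>1\<close> of \<open>pot\<close> is at most \<open>log 2 n\<close>.\<close>

lemma pot_le:
  assumes "2 \<le> n"
  shows "pot n \<le> (1 + 2 / \<eta>) * log 2 n"
proof -
  have "\<eta> * \<eta> \<le> 1 / 4 * \<eta>" using eta by (intro mult_right_mono) auto
  then have "\<eta> / 2 \<le> \<eta> - \<eta>\<^sup>2" using eta(1) by (simp add: power2_eq_square)
  also have "\<dots> \<le> ln (1 + \<eta>)" using eta by (intro ln_one_plus_pos_lower_bound) auto
  finally have ln: "\<eta> / 2 \<le> ln (1 + \<eta>)" .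
  have log: "1 \<le> log 2 n" using assms by (simp add: le_log_iff)
  have "ln n = log 2 n * ln 2" using assms by (simp add: log_def)
  also have "\<dots> \<le> log 2 n * 1"
    using log ln_le_minus_one[of "2::real"] by (intro mult_left_mono) auto
  finally have "ln n \<le> log 2 n" by simp
  then have "log (1 + \<eta>) n \<le> log 2 n / (\<eta> / 2)"
    unfolding log_def[of "1 + \<eta>"] using ln log eta by (intro frac_le) auto
  moreover have "pot n = 1 + log (1 + \<eta>) n" using assms by (simp add: pot_def)
  moreover have "(1 + 2 / \<eta>) * log 2 n = log 2 n + log 2 n / (\<eta> / 2)"
    by (simp add: algebra_simps)
  ultimately show ?thesis using log by linarith
qed

end

section \<open>Word sizes in bits, and transfer to the encoded protocol\<close>

lemma fits_words_bounded:
  assumes "bounded_words w tr" "w < 2 ^ s"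
  shows "fits_words s tr"
  using assms by (fastforce simp: fits_words_def bounded_words_def)

lemma less_power_word_size:
  assumes "1 \<le> b" "1 \<le> n"
  shows "n < 2 ^ word_size b n"
proof -
  have "n < 2 ^ floorlog 2 n" using floorlog_bounds[of n 2] assms by simp
  also have "(2::nat) ^ floorlog 2 n \<le> 2 ^ word_size b n"
    using assms by (intro power_increasing) (auto simp: word_size_def)
  finally show ?thesis .
qed

lemma tracks_quantile_encode:
  fixes P :: "('s::countable, 'c::countable) protocol"
  assumes "tracks_quantile k u \<epsilon> \<phi> P"
  shows "tracks_quantile k u \<epsilon> \<phi> (encode_protocol P)"
  unfolding tracks_quantile_def
proof (intro ballI allI impI)
  fix xs t assume "xs \<in> streams k u" "t \<le> length xs"
  then obtain tr ss c where r: "run P (take t xs) tr (ss, c)"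
    "is_approx_quantile u \<epsilon> \<phi> (mset (map snd (take t xs))) (coord_answer P c)"
    using assms unfolding tracks_quantile_def by blast
  have "run (encode_protocol P) (take t xs) tr (\<lambda>i. to_nat (ss i), to_nat c)"
    using run_encode[OF r(1)] by (simp add: encode_config_def)
  moreover have "coord_answer (encode_protocol P) (to_nat c) = coord_answer P c"
    by (simp add: encode_protocol_def)
  ultimately show "\<exists>tr ss c. run (encode_protocol P) (take t xs) tr (ss, c) \<and>
      is_approx_quantile u \<epsilon> \<phi> (mset (map snd (take t xs))) (coord_answer (encode_protocol P) c)"
    using r(2) by metis
qed

lemma (in quantile_tracking) tracks_quantile_tracker:
  "tracks_quantile k u (4 * \<eta>) \<phi> tracker"
  unfolding tracks_quantile_def
proof (intro ballI allI impI)
  fix xs t assume "xs \<in> streams k u" "t \<le> length xs"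
  then have "take t xs \<in> streams k u"
    by (auto simp: streams_def dest: in_set_takeD)
  from tracker_run[OF this] invariant_approx_quantile
  show "\<exists>tr ss c. run tracker (take t xs) tr (ss, c) \<and>
      is_approx_quantile u (4 * \<eta>) \<phi> (mset (map snd (take t xs))) (coord_answer tracker c)"
    by (metis fst_conv tracker_simps(6))
qed

text \<open>Streams of length at least \<open>4 * k\<close> make the block numbers fit into words;
  length at least \<open>2\<close> is what \<open>pot_le\<close> needs.\<close>

lemma (in quantile_tracking) cost_at_most_tracker:
  assumes "1 \<le> b"
  shows "cost_at_most b k u (max 2 (4 * k)) (\<lambda>n. 25 * k * (1 + 2 / \<eta>) * log 2 n)
    (encode_protocol tracker)"
  unfolding cost_at_most_def
proof (intro ballI allI impI)
  fix xs tr cfg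
  assume xs: "xs \<in> streams k u" and N: "max 2 (4 * k) \<le> length xs"
    and u_small: "u < 2 ^ word_size b (length xs)"
    and run: "run (encode_protocol tracker) xs tr cfg"
  from tracker_run[OF xs] obtain tr' ss x m0 R where
    r: "run tracker xs tr' (ss, (x, m0, R, Idle))" and inv: "invariant xs tr' ss x m0 R" by blast
  \<comment> \<open>Determinism identifies the given run with the one for which the invariant is
    known.\<close>
  have tr: "tr = tr'" using run_deterministic[OF run run_encode[OF r]] by simp
  have "1 \<le> length xs" using N unfolding max.bounded_iff by linarith
  then have "max (max u (length xs)) (4 * k) < 2 ^ word_size b (length xs)"
    using u_small N less_power_word_size[OF assms, of "length xs"] by simp
  then have "fits_words (word_size b (length xs)) tr"
    using inv unfolding tr invariant_def by (blast intro: fits_words_bounded)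
  moreover have "word_cost tr \<le> 25 * k * pot (length xs)"
    using invariant_cost[OF inv] by (simp add: tr)
  moreover have "25 * k * pot (length xs) \<le> 25 * k * ((1 + 2 / \<eta>) * log 2 (length xs))"
    using N unfolding max.bounded_iff by (intro mult_left_mono pot_le) auto
  ultimately show "fits_words (word_size b (length xs)) tr \<and>
      word_cost tr \<le> 25 * k * (1 + 2 / \<eta>) * log 2 (length xs)"
    unfolding mult.assoc by (blast intro: order_trans)
qed

lemma cost_at_most_mono:
  assumes "\<And>n. 1 \<le> n \<Longrightarrow> f n \<le> g n" "cost_at_most b k u N f P" "1 \<le> N"
  shows "cost_at_most b k u N g P"
  unfolding cost_at_most_def
proof (intro ballI allI impI)
  fix xs tr cfg
  assume *: "xs \<in> streams k u" "N \<le> length xs" "u < 2 ^ word_size b (length xs)" "run P xs tr cfg"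
  then have "fits_words (word_size b (length xs)) tr" "word_cost tr \<le> f (length xs)"
    using assms(2) unfolding cost_at_most_def by blast+
  moreover have "f (length xs) \<le> g (length xs)" using * assms by simp
  ultimately show "fits_words (word_size b (length xs)) tr \<and> word_cost tr \<le> g (length xs)"
    by linarith
qed

section \<open>The case \<open>\<epsilon> \<ge> 1\<close>, and the final assembly\<close>

definition silent :: "(nat, nat) protocol" where
  "silent =
     \<lparr>site_init = \<lambda>i. 0, site_item = \<lambda>s a. (s, []), site_recv = \<lambda>s m. (s, []),
      coord_init = 0, coord_recv = \<lambda>c j m. (c, []), coord_answer = \<lambda>c. 1\<rparr>"

lemma run_silent: "run silent xs [] (\<lambda>i. 0, 0)"
proof (induction xs rule: rev_induct)
  case Nil
  show ?case using run.start[of silent] by (simp add: silent_def)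
next
  case (snoc e xs)
  obtain j a where e: "e = (j, a)" by fastforce
  have "exchange silent ((\<lambda>i. 0)(j := 0), 0) (map (Up j) []) [] (\<lambda>i. 0, 0)"
    using exchange.quiet[of silent "(\<lambda>i. 0, 0)"] by (simp add: fun_upd_idem)
  from run.arrival[OF snoc.IH _ this, of a] show ?case by (simp add: e silent_def)
qed

text \<open>The fraction of smaller items lies in the unit interval, hence within distance
  \<open>1\<close> of \<open>\<phi>\<close>. For an empty multiset, division by zero makes it
  \<open>0\<close>, which also serves.\<close>

lemma is_approx_quantile_trivial:
  assumes "1 \<le> \<epsilon>" "\<phi> \<in> {0..1}" "x \<in> {1..u}"
  shows "is_approx_quantile u \<epsilon> \<phi> A x"
proof -
  define \<psi> where "\<psi> = real (size {#a \<in># A. a < x#}) / size A"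
  have sum: "size {#a \<in># A. a < x#} + size {#a \<in># A. x < a#} \<le> size A"
  proof (induction A)
    case empty
    then show ?case by simp
  next
    case (add a A)
    then show ?case by auto
  qed
  then have "size {#a \<in># A. a < x#} \<le> size A" by simp
  then have "\<psi> \<le> 1" by (cases "A = {#}") (simp_all add: \<psi>_def divide_le_eq_1 nonempty_has_size[symmetric])
  moreover have "0 \<le> \<psi>" by (simp add: \<psi>_def)
  moreover have "real (size {#a \<in># A. a < x#}) = \<psi> * size A" by (cases "A = {#}") (auto simp: \<psi>_def)
  moreover from this have "size {#a \<in># A. x < a#} \<le> (1 - \<psi>) * size A"
    using of_nat_mono[OF sum, where 'a = real] by (simp add: algebra_simps)
  ultimately show ?thesis
    using assms unfolding is_approx_quantile_def is_quantile_def
    by (intro exI[of _ \<psi>]) auto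
qed

theorem theorem3:
  fixes b :: nat
  assumes "b \<ge> 1"
  shows "\<exists>C > (0::real). \<forall>k \<ge> (2::nat). \<forall>\<epsilon> > (0::real). \<exists>N::nat. \<forall>\<phi> \<in> {0..1::real}. \<forall>u \<ge> (1::nat).
         \<exists>P :: (nat, nat) protocol.
           addresses_sites k P \<and>
           tracks_quantile k u \<epsilon> \<phi> P \<and>
           cost_at_most b k u N (\<lambda>n. C * (real k / \<epsilon>) * log 2 (real n)) P"
proof (intro exI[of _ "225::real"] conjI allI impI)
  fix k :: nat and \<epsilon> :: real
  assume k: "2 \<le> k" and eps: "0 < \<epsilon>"
  show "\<exists>N::nat. \<forall>\<phi> \<in> {0..1::real}. \<forall>u \<ge> (1::nat). \<exists>P :: (nat, nat) protocol.
      addresses_sites k P \<and> tracks_quantile k u \<epsilon> \<phi> P \<and>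
      cost_at_most b k u N (\<lambda>n. 225 * (real k / \<epsilon>) * log 2 (real n)) P"
  proof (intro exI[of _ "max 2 (4 * k)"] ballI allI impI)
    fix \<phi> :: real and u :: nat
    assume phi: "\<phi> \<in> {0..1}" and u: "1 \<le> u"
    show "\<exists>P :: (nat, nat) protocol. addresses_sites k P \<and> tracks_quantile k u \<epsilon> \<phi> P \<and>
      cost_at_most b k u (max 2 (4 * k)) (\<lambda>n. 225 * (real k / \<epsilon>) * log 2 (real n)) P"
    proof (cases "\<epsilon> < 1")
      case True
      \<comment> \<open>The tracker's error is \<open>4 * \<eta>\<close>, so \<open>\<eta>\<close>
        is a quarter of \<open>\<epsilon>\<close>.\<close>
      interpret quantile_tracking k u "\<epsilon> / 4" \<phi>
        by unfold_locales (use True eps k u phi in auto)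
      have "25 * k * (1 + 2 / (\<epsilon> / 4)) * log 2 n \<le> 225 * (real k / \<epsilon>) * log 2 n"
        if "1 \<le> n" for n :: nat
      proof (intro mult_right_mono)
        \<comment> \<open>\<open>1 + 8 / \<epsilon> \<le> 9 / \<epsilon>\<close> because
          \<open>\<epsilon> < 1\<close>; the constant is \<open>25 * 9 = 225\<close>.\<close>
        have "1 + 2 / (\<epsilon> / 4) \<le> 9 / \<epsilon>" using True eps by (simp add: field_simps)
        then have "25 * k * (1 + 2 / (\<epsilon> / 4)) \<le> 25 * k * (9 / \<epsilon>)" by (intro mult_left_mono) auto
        then show "25 * k * (1 + 2 / (\<epsilon> / 4)) \<le> 225 * (real k / \<epsilon>)" by simp
        show "0 \<le> log 2 n" using that by simp
      qed
      then have "cost_at_most b k u (max 2 (4 * k)) (\<lambda>n. 225 * (real k / \<epsilon>) * log 2 (real n))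
          (encode_protocol tracker)"
        using cost_at_most_tracker[OF assms] by (rule cost_at_most_mono) auto
      with tracks_quantile_encode[OF tracks_quantile_tracker]
        addresses_sites_encode[OF addresses_sites_tracker]
      show ?thesis by auto
    next
      case False
      have "addresses_sites k silent" by (simp add: addresses_sites_def silent_def)
      moreover have "tracks_quantile k u \<epsilon> \<phi> silent"
        unfolding tracks_quantile_def
        using run_silent is_approx_quantile_trivial[of \<epsilon> \<phi> 1 u] False phi u
        by (fastforce simp: silent_def)
      moreover have "cost_at_most b k u (max 2 (4 * k)) (\<lambda>n. 225 * (real k / \<epsilon>) * log 2 (real n)) silent"
        unfolding cost_at_most_def
      proof (intro ballI allI impI)
        fix xs tr cfg
        assume *: "max 2 (4 * k) \<le> length xs" and "run silent xs tr cfg"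
        then have "tr = []" using run_deterministic[OF _ run_silent] by blast
        moreover from * have "1 \<le> real (length xs)" unfolding max.bounded_iff by linarith
        then have "0 \<le> log 2 (length xs)" by (subst zero_le_log_cancel_iff) auto
        ultimately show "fits_words (word_size b (length xs)) tr \<and>
            word_cost tr \<le> 225 * (real k / \<epsilon>) * log 2 (length xs)"
          using eps by (simp add: fits_words_def)
      qed
      ultimately show ?thesis by blast
    qed
  qed
qed simp

end
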